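(* For arbitrary values of the parameters $q\neq0$, $b\neq0$, the equation $$v_z+q\,\frac{v_{zz}-v_z}{\big(1-b(v_{zz}-v_z)\big)^2}=0\qquad(\ast)$$ can be reduced to the set of first order differential equations which consists of the equations $$v_z=0,\qquad v_z=\frac{-1\pm\sqrt q}{b},$$ and of the following equations, in which $$p=\sqrt{1-\frac{4b}{q}v_z}$$ and $c$ is an arbitrary constant. For $q\neq1$, $q>0$: $$2q\log(p-1)+(q-\sqrt q-2)\log\big((p+1)\sqrt q-2\big)+(q+\sqrt q-2)\log\big((p+1)\sqrt q+2\big)=2(q-1)z+c,$$ $$2q\log(p+1)+(q+\sqrt q-2)\log\big((p-1)\sqrt q-2\big)+(q-\sqrt q-2)\log\big((p-1)\sqrt q+2\big)=2(q-1)z+c.$$ For $q=1$: $$\frac{1}{1-p}+\frac14\log\frac{(p+3)^3}{(p-1)^5}=z+c,$$ $$\frac{1}{p+1}+\frac14\log\frac{(p-3)^3}{(p+1)^5}=z+c.$$ For $q<0$: $$2\sqrt{-q}\,\arctan\!\Big(\frac{(p+1)\sqrt{-q}}{2}\Big)-2q\log(p-1)+(2-q)\log\big(4-q(p+1)^2\big)=2(1-q)z+c,$$ $$-2\sqrt{-q}\,\arctan\!\Big(\frac{(p-1)\sqrt{-q}}{2}\Big)-2q\log(1+p)+(2-q)\log\big(4-q(p-1)^2\big)=2(1-q)z+c.$$ The complete set of solutions of $(\ast)$ coincides with the union of the solutions of these first order equations.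
   Context: Here $v=v(z)$ is the unknown function and subscripts denote derivatives in $z$. The parameter $q$ has the form $q=\sigma^2/(2a)$ with $\sigma$ a volatility constant and $a\neq0$. It is assumed throughout that the denominator $1-b(v_{zz}-v_z)$ in $(\ast)$ is not equal to zero.
   Formalization: For q=1 the logarithms are corrected to log((p+3)^3(p-1)^5) and log((p-3)^3(p+1)^5); for q=4 solutions of (∗) are twice differentiable gluings of first order solutions at finitely many points with p=0, as some solutions cross p=0. log x is read as ln|x|. *)

theory Defs
  imports "HOL-Analysis.Analysis"
begin

text \<open>
  Solutions are real functions on an open interval \<open>I\<close>; only the values on \<open>I\<close> matter.
  No continuity of the highest derivative is required.
\<close>

definition twice_differentiable_on :: "(real \<Rightarrow> real) \<Rightarrow> real set \<Rightarrow> bool" where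
  "twice_differentiable_on v I \<longleftrightarrow>
     (\<forall>z\<in>I. v differentiable (at z) \<and> deriv v differentiable (at z))"

definition second_order_solutions :: "real \<Rightarrow> real \<Rightarrow> real set \<Rightarrow> (real \<Rightarrow> real) set" where
  "second_order_solutions q b I = {v. twice_differentiable_on v I \<and>
     (\<forall>z\<in>I. 1 - b * (deriv (deriv v) z - deriv v z) \<noteq> 0 \<and>
        deriv v z + q * ((deriv (deriv v) z - deriv v z) /
          (1 - b * (deriv (deriv v) z - deriv v z))\<^sup>2) = 0)}"

definition linear_solutions :: "real \<Rightarrow> real set \<Rightarrow> (real \<Rightarrow> real) set" where
  "linear_solutions m I = {v. \<forall>z\<in>I. (v has_real_derivative m) (at z)}"

definition p_of :: "real \<Rightarrow> real \<Rightarrow> (real \<Rightarrow> real) \<Rightarrow> real \<Rightarrow> real" where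
  "p_of q b v z = sqrt (1 - 4 * b / q * deriv v z)"

text \<open>
  The implicit equations, as relations between \<open>p\<close>, \<open>z\<close> and the constant \<open>c\<close>.  The logarithms
  arise as primitives of \<open>1 / x\<close> on either side of \<open>0\<close> (\<open>p < 1\<close> does occur), so \<open>log x\<close> is read
  as \<open>ln \<bar>x\<bar>\<close>.  As \<open>ln 0 = 0\<close> and \<open>x / 0 = 0\<close> in HOL, it is required explicitly that
  arguments of logarithms and denominators do not vanish.
\<close>

definition eq_gt_upper :: "real \<Rightarrow> real \<Rightarrow> real \<Rightarrow> real \<Rightarrow> bool" where
  "eq_gt_upper q p z c \<longleftrightarrow>
     p - 1 \<noteq> 0 \<and> (p + 1) * sqrt q - 2 \<noteq> 0 \<and> (p + 1) * sqrt q + 2 \<noteq> 0 \<and>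
     2 * q * ln \<bar>p - 1\<bar> + (q - sqrt q - 2) * ln \<bar>(p + 1) * sqrt q - 2\<bar>
       + (q + sqrt q - 2) * ln \<bar>(p + 1) * sqrt q + 2\<bar> = 2 * (q - 1) * z + c"

definition eq_gt_lower :: "real \<Rightarrow> real \<Rightarrow> real \<Rightarrow> real \<Rightarrow> bool" where
  "eq_gt_lower q p z c \<longleftrightarrow>
     p + 1 \<noteq> 0 \<and> (p - 1) * sqrt q - 2 \<noteq> 0 \<and> (p - 1) * sqrt q + 2 \<noteq> 0 \<and>
     2 * q * ln \<bar>p + 1\<bar> + (q + sqrt q - 2) * ln \<bar>(p - 1) * sqrt q - 2\<bar>
       + (q - sqrt q - 2) * ln \<bar>(p - 1) * sqrt q + 2\<bar> = 2 * (q - 1) * z + c"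

text \<open>
  For \<open>q = 1\<close> the first equation has to be a primitive of
  \<open>2 p (1 + p) / ((p - 1)\<^sup>2 (p + 3)) = 1 / (p - 1)\<^sup>2 + (5/4) / (p - 1) + (3/4) / (p + 3)\<close>;
  the second one results from it by \<open>p \<mapsto> - p\<close>.  Hence the fifth powers are factors
  inside the logarithms.  The published formulas have them as denominators, which gives the
  term \<open>(5/4) / (p - 1)\<close> the wrong sign.
\<close>

definition eq_one_upper :: "real \<Rightarrow> real \<Rightarrow> real \<Rightarrow> bool" where
  "eq_one_upper p z c \<longleftrightarrow> 1 - p \<noteq> 0 \<and> (p + 3) ^ 3 * (p - 1) ^ 5 \<noteq> 0 \<and>
     1 / (1 - p) + 1 / 4 * ln \<bar>(p + 3) ^ 3 * (p - 1) ^ 5\<bar> = z + c"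

definition eq_one_lower :: "real \<Rightarrow> real \<Rightarrow> real \<Rightarrow> bool" where
  "eq_one_lower p z c \<longleftrightarrow> p + 1 \<noteq> 0 \<and> (p - 3) ^ 3 * (p + 1) ^ 5 \<noteq> 0 \<and>
     1 / (p + 1) + 1 / 4 * ln \<bar>(p - 3) ^ 3 * (p + 1) ^ 5\<bar> = z + c"

definition eq_neg_upper :: "real \<Rightarrow> real \<Rightarrow> real \<Rightarrow> real \<Rightarrow> bool" where
  "eq_neg_upper q p z c \<longleftrightarrow> p - 1 \<noteq> 0 \<and> 4 - q * (p + 1)\<^sup>2 \<noteq> 0 \<and>
     2 * sqrt (- q) * arctan ((p + 1) * sqrt (- q) / 2) - 2 * q * ln \<bar>p - 1\<bar>
       + (2 - q) * ln \<bar>4 - q * (p + 1)\<^sup>2\<bar> = 2 * (1 - q) * z + c"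

definition eq_neg_lower :: "real \<Rightarrow> real \<Rightarrow> real \<Rightarrow> real \<Rightarrow> bool" where
  "eq_neg_lower q p z c \<longleftrightarrow> 1 + p \<noteq> 0 \<and> 4 - q * (p - 1)\<^sup>2 \<noteq> 0 \<and>
     - 2 * sqrt (- q) * arctan ((p - 1) * sqrt (- q) / 2) - 2 * q * ln \<bar>1 + p\<bar>
       + (2 - q) * ln \<bar>4 - q * (p - 1)\<^sup>2\<bar> = 2 * (1 - q) * z + c"

text \<open>
  The radicand is required to be nonnegative because \<open>sqrt\<close> is odd in HOL.
  The constant \<open>c\<close> is the same on all of \<open>I\<close>.
\<close>

definition implicit_solutions ::
  "(real \<Rightarrow> real \<Rightarrow> real \<Rightarrow> bool) \<Rightarrow> real \<Rightarrow> real \<Rightarrow> real set \<Rightarrow> (real \<Rightarrow> real) set" where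
  "implicit_solutions E q b I = {v.
     (\<forall>z\<in>I. v differentiable (at z) \<and> 0 \<le> 1 - 4 * b / q * deriv v z) \<and>
     (\<exists>c. \<forall>z\<in>I. E (p_of q b v z) z c)}"

text \<open>For \<open>q < 0\<close> the slopes \<open>(-1 \<plusminus> \<surd>q) / b\<close> are not real and contribute no real solutions.\<close>

definition first_order_solutions :: "real \<Rightarrow> real \<Rightarrow> real set \<Rightarrow> (real \<Rightarrow> real) set" where
  "first_order_solutions q b I =
     linear_solutions 0 I \<union>
     (if q > 0 then linear_solutions ((- 1 + sqrt q) / b) I \<union>
                    linear_solutions ((- 1 - sqrt q) / b) I else {}) \<union>
     (if q < 0 then
        implicit_solutions (eq_neg_upper q) q b I \<union> implicit_solutions (eq_neg_lower q) q b I
      else if q = 1 then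
        implicit_solutions eq_one_upper q b I \<union> implicit_solutions eq_one_lower q b I
      else
        implicit_solutions (eq_gt_upper q) q b I \<union> implicit_solutions (eq_gt_lower q) q b I)"

text \<open>
  Twice differentiable functions composed of finitely many solutions of the first order equations,
  joined at points where \<open>p = 0\<close>.  At such points the two values of \<open>v\<^sub>z\<^sub>z\<close> admitted by the second
  order equation coincide.  For \<open>q = 4\<close> they are points of non-uniqueness:
  there a solution can change from the first implicit equation to \<open>v\<^sub>z = (-1 + \<surd>q) / b\<close>, and from
  either of these to the second implicit equation.
\<close>

definition glued_first_order_solutions ::
  "real \<Rightarrow> real \<Rightarrow> real set \<Rightarrow> (real \<Rightarrow> real) set" where
  "glued_first_order_solutions q b I = {v. twice_differentiable_on v I \<and>
     (\<exists>D. finite D \<and> D \<subseteq> I \<and> (\<forall>z\<in>D. p_of q b v z = 0) \<and>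
        (\<forall>J. open J \<and> is_interval J \<and> J \<subseteq> I - D \<longrightarrow> v \<in> first_order_solutions q b J))}"

end

theory Submission
  imports Defs
begin

text \<open>
  Put \<open>s = 2 / (1 - b (v\<^sub>z\<^sub>z - v\<^sub>z)) - 1\<close>.  The second order equation says that
  \<open>v\<^sub>z = q (1 - s\<^sup>2) / (4 b)\<close>, hence \<open>p = \<bar>s\<bar>\<close>, and differentiating gives
  \<open>s s\<^sub>z = (s - 1) (q (s + 1)\<^sup>2 - 4) / (2 q (s + 1))\<close>.  The zeros of the right hand side are the
  linear solutions, and separating the variables gives the implicit equations, the two signs
  \<open>s = \<plusminus> p\<close> being the two branches.  Since \<open>v\<^sub>z\<^sub>z\<close> is not assumed continuous, constancy of the
  branch rests on the intermediate value property of derivatives.  A change of branch requires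
  \<open>s = 0\<close>, where \<open>v\<^sub>z\<close> is extremal while \<open>v\<^sub>z\<^sub>z = (q - 4) / (4 b)\<close>; this excludes it unless
  \<open>q = 4\<close>.  Conversely, a solution of an implicit equation cannot reach \<open>s = 0\<close> or \<open>s = - 1\<close>,
  because there the primitive has a strict extremum in \<open>s\<close>, while it is strictly monotone in
  \<open>z\<close> along the solution.
\<close>

section \<open>Derivatives of real functions\<close>

text \<open>This is the intermediate value property of derivatives, which replaces continuity of the
  second derivative later on. By Rolle's theorem \<open>f\<close> is injective on the segment from
  \<open>x\<close> to \<open>y\<close>, hence strictly monotone there, whereas derivatives of
  opposite signs would make it rise at one end and fall at the other.\<close>

lemma deriv_nonzero_constant_sign:
  fixes f f' :: "real \<Rightarrow> real"
  assumes "is_interval I"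
    and der: "\<And>z. z \<in> I \<Longrightarrow> (f has_real_derivative f' z) (at z)"
    and nz: "\<And>z. z \<in> I \<Longrightarrow> f' z \<noteq> 0"
  shows "(\<forall>z\<in>I. f' z > 0) \<or> (\<forall>z\<in>I. f' z < 0)"
proof -
  have *: False if xy: "x \<in> I" "y \<in> I" "f' x * f' y < 0" "x < y" for x y
  proof -
    have sub: "{x..y} \<subseteq> I"
      using assms(1) that(1,2) unfolding is_interval_1 by (meson atLeastAtMost_iff subsetI)
    have cont: "continuous_on {x..y} f"
      using DERIV_isCont[OF der] sub by (intro continuous_at_imp_continuous_on) blast
    have "inj_on f {x..y}"
    proof (rule linorder_inj_onI)
      fix a c assume ac: "a < c" "a \<in> {x..y}" "c \<in> {x..y}"
      show "f a \<noteq> f c"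
      proof
        assume eq: "f a = f c"
        have "\<And>z. a < z \<Longrightarrow> z < c \<Longrightarrow> (f has_derivative (*) (f' z)) (at z)"
        proof -
          fix z assume "a < z" "z < c"
          then have "z \<in> I"
            using sub ac by auto
          then show "(f has_derivative (*) (f' z)) (at z)"
            using der has_field_derivative_imp_has_derivative by blast
        qed
        moreover have "continuous_on {a..c} f"
          using cont by (rule continuous_on_subset) (use ac in auto)
        ultimately obtain z where z: "a < z" "z < c" "(*) (f' z) = (\<lambda>v. 0)"
          using Rolle_deriv[OF ac(1) eq, of "\<lambda>z. (*) (f' z)"] by blast
        then have "z \<in> I"
          using sub ac by auto
        then show False
          using nz fun_cong[OF z(3), of 1] by simp
      qed
    qed auto
    then have mono: "(f x < f z \<and> f z < f y) \<or> (f y < f z \<and> f z < f x)" if "x < z" "z < y" for z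
      using continuous_inj_imp_mono[OF that cont] by blast
    consider "f' x > 0" "f' y < 0" | "f' x < 0" "f' y > 0"
      using \<open>f' x * f' y < 0\<close> by (auto simp: mult_less_0_iff)
    then show False
    proof cases
      case 1
      obtain d where d: "d > 0" "\<And>h. 0 < h \<Longrightarrow> h < d \<Longrightarrow> f x < f (x + h)"
        using DERIV_pos_inc_right[OF der[OF xy(1)] 1(1)] by blast
      obtain e where e: "e > 0" "\<And>h. 0 < h \<Longrightarrow> h < e \<Longrightarrow> f y < f (y - h)"
        using DERIV_neg_dec_left[OF der[OF xy(2)] 1(2)] by blast
      \<comment> \<open>One offset \<open>h\<close> serves both ends. That \<open>f (x + h)\<close>
        exceeds \<open>f x\<close> forces the increasing alternative of \<open>mono\<close>, that
        \<open>f (y - h)\<close> exceeds \<open>f y\<close> the decreasing one.\<close>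
      obtain h where "0 < h" "h < min (min d e) (y - x)"
        using dense[of 0 "min (min d e) (y - x)"] d(1) e(1) \<open>x < y\<close> by auto
      then have h: "0 < h" "h < d" "h < e" "x < x + h" "x + h < y" "x < y - h" "y - h < y"
        by simp_all
      show False
        using d(2)[OF h(1,2)] e(2)[OF h(1,3)] mono[OF h(4,5)] mono[OF h(6,7)] by linarith
    next
      case 2
      obtain d where d: "d > 0" "\<And>h. 0 < h \<Longrightarrow> h < d \<Longrightarrow> f x > f (x + h)"
        using DERIV_neg_dec_right[OF der[OF xy(1)] 2(1)] by blast
      obtain e where e: "e > 0" "\<And>h. 0 < h \<Longrightarrow> h < e \<Longrightarrow> f y > f (y - h)"
        using DERIV_pos_inc_left[OF der[OF xy(2)] 2(2)] by blast
      obtain h where "0 < h" "h < min (min d e) (y - x)"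
        using dense[of 0 "min (min d e) (y - x)"] d(1) e(1) \<open>x < y\<close> by auto
      then have h: "0 < h" "h < d" "h < e" "x < x + h" "x + h < y" "x < y - h" "y - h < y"
        by simp_all
      show False
        using d(2)[OF h(1,2)] e(2)[OF h(1,3)] mono[OF h(4,5)] mono[OF h(6,7)] by linarith
    qed
  qed
  have "f' x * f' y > 0" if "x \<in> I" "y \<in> I" for x y
  proof (rule ccontr)
    assume "\<not> f' x * f' y > 0"
    then have neg: "f' x * f' y < 0"
      using nz[of x] nz[of y] that by (simp add: not_less order_le_less)
    then have "x \<noteq> y"
      by (auto simp: mult_less_0_iff)
    then show False
      using *[of x y] *[of y x] that neg by (auto simp: mult.commute neq_iff)
  qed
  then have same: "f' x > 0 \<longleftrightarrow> f' y > 0" if "x \<in> I" "y \<in> I" for x y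
    using that by (meson not_less_iff_gr_or_eq zero_less_mult_iff)
  show ?thesis
  proof (cases "\<exists>x\<in>I. f' x > 0")
    case True
    then show ?thesis
      using same by blast
  next
    case False
    then show ?thesis
      using nz by (meson linorder_neqE_linordered_idom)
  qed
qed

text \<open>An injective derivative takes a value \<open>k\<close> other than \<open>f' z\<close> at
  most once, so it avoids \<open>k\<close> on a ball around \<open>z\<close>. The sign lemma for
  \<open>f y - k * y\<close> then keeps \<open>f'\<close> on one side of \<open>k\<close> on this
  ball; doing so for all \<open>k\<close> below and above \<open>f' z\<close> gives
  continuity.\<close>

lemma inj_derivative_isCont:
  fixes f f' :: "real \<Rightarrow> real"
  assumes "open I" and "z \<in> I"
    and der: "\<And>z. z \<in> I \<Longrightarrow> (f has_real_derivative f' z) (at z)"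
    and inj: "inj_on f' I"
  shows "isCont f' z"
proof -
  have avoid: "\<exists>J. open J \<and> is_interval J \<and> z \<in> J \<and> J \<subseteq> I \<and>
      ((\<forall>y\<in>J. f' y > k) \<or> (\<forall>y\<in>J. f' y < k))" if "k \<noteq> f' z" for k
  proof -
    \<comment> \<open>By injectivity at most one point is removed, so \<open>T\<close> stays
      open.\<close>
    define T where "T = I - {y \<in> I. f' y = k}"
    have "finite {y \<in> I. f' y = k}"
      using finite_vimage_IntI[OF _ inj, of "{k}"] by (simp add: vimage_def Int_def conj_commute)
    then have "open T"
      using \<open>open I\<close> unfolding T_def by (intro open_Diff finite_imp_closed)
    moreover have "z \<in> T"
      using that \<open>z \<in> I\<close> by (auto simp: T_def)
    ultimately obtain e where e: "e > 0" "ball z e \<subseteq> T"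
      by (meson open_contains_ball)
    have "(\<forall>y\<in>ball z e. f' y - k > 0) \<or> (\<forall>y\<in>ball z e. f' y - k < 0)"
    proof (rule deriv_nonzero_constant_sign[where f="\<lambda>y. f y - k * y"])
      fix y assume "y \<in> ball z e"
      then have "y \<in> T" using e by blast
      then show "f' y - k \<noteq> 0" and "((\<lambda>y. f y - k * y) has_real_derivative f' y - k) (at y)"
        using der[of y] by (auto simp: T_def intro!: derivative_eq_intros)
    qed (simp add: is_interval_ball_real)
    then show ?thesis
      using e by (intro exI[of _ "ball z e"]) (auto simp: is_interval_ball_real T_def)
  qed
  show ?thesis
    unfolding isCont_def
  proof (rule order_tendstoI)
    fix k assume "k < f' z"
    then obtain J where J: "open J" "z \<in> J" "(\<forall>y\<in>J. f' y > k) \<or> (\<forall>y\<in>J. f' y < k)"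
      using avoid[of k] by auto
    then have "\<forall>y\<in>J. f' y > k"
      using \<open>k < f' z\<close> by force
    then show "\<forall>\<^sub>F y in at z. k < f' y"
      using J unfolding eventually_at_topological by blast
  next
    fix k assume "f' z < k"
    then obtain J where J: "open J" "z \<in> J" "(\<forall>y\<in>J. f' y > k) \<or> (\<forall>y\<in>J. f' y < k)"
      using avoid[of k] by auto
    then have "\<forall>y\<in>J. f' y < k"
      using \<open>f' z < k\<close> by force
    then show "\<forall>\<^sub>F y in at z. f' y < k"
      using J unfolding eventually_at_topological by blast
  qed
qed

text \<open>The integrating factor \<open>exp (- A)\<close>, with \<open>A\<close> a primitive of
  \<open>a\<close>, makes \<open>y x * exp (- A x)\<close> constant on the segment joining
  \<open>z0\<close> and \<open>z1\<close>.\<close>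

lemma linear_ode_zero:
  fixes y a :: "real \<Rightarrow> real"
  assumes "is_interval I"
    and der: "\<And>z. z \<in> I \<Longrightarrow> (y has_real_derivative a z * y z) (at z)"
    and cont: "continuous_on I a"
    and z0: "z0 \<in> I" "y z0 = 0" and z1: "z1 \<in> I"
  shows "y z1 = 0"
proof -
  let ?l = "min z0 z1" and ?r = "max z0 z1"
  have sub: "{?l..?r} \<subseteq> I"
    using assms(1) z0(1) z1 unfolding is_interval_1
    by (metis atLeastAtMost_iff max_def min_def subsetI)
  obtain A where A: "\<And>x. x \<in> {?l..?r} \<Longrightarrow> (A has_vector_derivative a x) (at x within {?l..?r})"
    using antiderivative_continuous[OF continuous_on_subset[OF cont sub]] by metis
  have "\<exists>c. \<forall>x\<in>{?l..?r}. y x * exp (- A x) = c"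
  proof (rule has_field_derivative_zero_constant)
    fix x assume x: "x \<in> {?l..?r}"
    have "(A has_real_derivative a x) (at x within {?l..?r})"
      using A[OF x] by (simp add: has_real_derivative_iff_has_vector_derivative)
    moreover have "(y has_real_derivative a x * y x) (at x within {?l..?r})"
      using has_field_derivative_at_within[OF der] sub x by blast
    ultimately show "((\<lambda>x. y x * exp (- A x)) has_real_derivative 0) (at x within {?l..?r})"
      by (auto intro!: derivative_eq_intros)
  qed simp
  then have "y z1 * exp (- A z1) = y z0 * exp (- A z0)"
    by (metis atLeastAtMost_iff max.cobounded1 max.cobounded2 min.cobounded1 min.cobounded2)
  then show ?thesis
    using z0 by simp
qed

text \<open>The derivative of \<open>G\<close> changes sign exactly once near \<open>s z0\<close>,
  so \<open>G\<close> has an extremum there and \<open>G x - G (s z0)\<close> keeps its sign nearby.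
  Along the continuous curve \<open>s\<close> this difference equals
  \<open>\<alpha> * (z - z0)\<close>, which takes both signs.\<close>

lemma no_passage_through_simple_critical_point:
  fixes G h s :: "real \<Rightarrow> real"
  assumes "open I" and "z0 \<in> I" and "isCont s z0" and "\<alpha> \<noteq> 0"
    and eq: "\<And>z. z \<in> I \<Longrightarrow> G (s z) = \<alpha> * z + c"
    and "open U" and "s z0 \<in> U"
    and der: "\<And>x. x \<in> U \<Longrightarrow> (G has_real_derivative (x - s z0) * h x) (at x)"
    and "isCont h (s z0)" and "h (s z0) \<noteq> 0"
  shows False
proof -
  let ?k = "s z0"
  have "((\<lambda>x. h x * h ?k) \<longlongrightarrow> h ?k * h ?k) (at ?k)"
    using \<open>isCont h ?k\<close> by (auto intro!: tendsto_intros simp: isCont_def)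
  moreover have "h ?k * h ?k > 0"
    using \<open>h ?k \<noteq> 0\<close> by (auto simp: zero_less_mult_iff)
  ultimately have "\<forall>\<^sub>F x in at ?k. h x * h ?k > 0"
    by (rule order_tendstoD)
  then obtain V where V: "open V" "?k \<in> V" "\<And>x. x \<in> V \<Longrightarrow> x \<noteq> ?k \<Longrightarrow> h x * h ?k > 0"
    unfolding eventually_at_topological by blast
  obtain e where e: "e > 0" "ball ?k e \<subseteq> U \<inter> V"
    by (meson V IntI \<open>open U\<close> \<open>?k \<in> U\<close> open_Int open_contains_ball)
  have pos: "(G x - G ?k) * h ?k \<ge> 0" if "x \<in> ball ?k e" for x
  proof (cases "x = ?k")
    case False
    have seg: "{min x ?k..max x ?k} \<subseteq> ball ?k e"
      using that by (auto simp: dist_real_def)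
    have lt: "min x ?k < max x ?k"
      using False by auto
    have dG: "(G has_real_derivative (y - ?k) * h y) (at y)" if "y \<in> {min x ?k..max x ?k}" for y
      using that seg e der by blast
    obtain \<xi> where xi: "min x ?k < \<xi>" "\<xi> < max x ?k"
        "G (max x ?k) - G (min x ?k) = (max x ?k - min x ?k) * ((\<xi> - ?k) * h \<xi>)"
      using MVT2[OF lt, of G "\<lambda>y. (y - ?k) * h y"] dG by auto
    then have *: "G x - G ?k = (x - ?k) * ((\<xi> - ?k) * h \<xi>)"
      by (auto simp: max_def min_def algebra_simps split: if_splits)
    have "(x - ?k) * (\<xi> - ?k) \<ge> 0"
      using xi by (auto simp: max_def min_def zero_le_mult_iff split: if_splits)
    moreover have "h \<xi> * h ?k > 0"
    proof (rule V(3))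
      have "\<xi> \<in> {min x ?k..max x ?k}"
        using xi by simp
      then show "\<xi> \<in> V"
        using seg e by blast
    qed (use xi in auto)
    ultimately have "((x - ?k) * (\<xi> - ?k)) * (h \<xi> * h ?k) \<ge> 0"
      by simp
    then show ?thesis
      unfolding * by (simp add: algebra_simps)
  qed simp
  have "\<forall>\<^sub>F z in at z0. s z \<in> ball ?k e"
    using \<open>isCont s z0\<close> e by (intro topological_tendstoD) (auto simp: isCont_def)
  then obtain W where W: "open W" "z0 \<in> W" "\<And>z. z \<in> W \<Longrightarrow> z \<noteq> z0 \<Longrightarrow> s z \<in> ball ?k e"
    unfolding eventually_at_topological by blast
  obtain d where d: "d > 0" "ball z0 d \<subseteq> I \<inter> W"
    by (meson W IntI \<open>open I\<close> \<open>z0 \<in> I\<close> open_Int open_contains_ball)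
  have "(\<alpha> * (z - z0)) * h ?k \<ge> 0" if "z \<in> ball z0 d" for z
  proof (cases "z = z0")
    case False
    have "z \<in> I" "z \<in> W"
      using that d by auto
    then show ?thesis
      using pos[OF W(3)[OF _ False]] eq[of z] eq[OF \<open>z0 \<in> I\<close>] by (simp add: algebra_simps)
  qed simp
  \<comment> \<open>The two points symmetric about \<open>z0\<close> give opposite inequalities for
    the same number, which must therefore be zero.\<close>
  from this[of "z0 + d / 2"] this[of "z0 - d / 2"]
  have "\<alpha> * (d / 2) * h ?k = 0"
    using d by (auto simp: dist_real_def)
  then show False
    using d \<open>\<alpha> \<noteq> 0\<close> \<open>h ?k \<noteq> 0\<close> by simp
qed

section \<open>From the first order equations to the second order equation\<close>

text \<open>Here \<open>u\<close> stands for the first derivative and \<open>w\<close> for the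
  second minus the first. With \<open>d = 1 - b * w\<close> the equation makes \<open>u\<close> a
  quadratic polynomial in \<open>1 / d\<close>, namely
  \<open>- (q / b) * (1 / d\<^sup>2 - 1 / d)\<close>. Completing the square leads to
  \<open>s = 2 / d - 1\<close>, a rational parameter of the curve in the plane of \<open>u\<close>
  and \<open>w\<close>.\<close>

lemma second_order_parametrization:
  fixes q b u w s :: real
  assumes "q \<noteq> 0" "b \<noteq> 0"
  shows "s \<noteq> - 1 \<and> u = q * (1 - s\<^sup>2) / (4 * b) \<and> w = (s - 1) / (b * (s + 1)) \<longleftrightarrow>
    1 - b * w \<noteq> 0 \<and> u + q * (w / (1 - b * w)\<^sup>2) = 0 \<and> s = 2 / (1 - b * w) - 1"
proof
  assume L: "s \<noteq> - 1 \<and> u = q * (1 - s\<^sup>2) / (4 * b) \<and> w = (s - 1) / (b * (s + 1))"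
  then have s: "s + 1 \<noteq> 0" by auto
  have "b * w = (s - 1) / (s + 1)"
    using L assms by simp
  then have bw: "1 - b * w = 2 / (s + 1)"
    using s by (simp add: field_simps)
  have "w / (2 / (s + 1))\<^sup>2 = (s - 1) * (s + 1) / (4 * b)"
    using L s assms by (simp add: power2_eq_square)
  then have "u + q * (w / (1 - b * w)\<^sup>2) = u + q * ((s - 1) * (s + 1) / (4 * b))"
    by (simp only: bw)
  also have "\<dots> = 0"
    using L assms by (simp add: field_simps power2_eq_square)
  finally have "u + q * (w / (1 - b * w)\<^sup>2) = 0" .
  then show "1 - b * w \<noteq> 0 \<and> u + q * (w / (1 - b * w)\<^sup>2) = 0 \<and> s = 2 / (1 - b * w) - 1"
    using s by (simp add: bw add_divide_distrib)
next
  assume R: "1 - b * w \<noteq> 0 \<and> u + q * (w / (1 - b * w)\<^sup>2) = 0 \<and> s = 2 / (1 - b * w) - 1"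
  define d where "d = 1 - b * w"
  have w: "w = (1 - d) / b"
    using assms by (simp add: d_def)
  have d: "d \<noteq> 0" "s = 2 / d - 1" "u = - (q * (w / d\<^sup>2))"
    using R by (auto simp: d_def eq_neg_iff_add_eq_0)
  show "s \<noteq> - 1 \<and> u = q * (1 - s\<^sup>2) / (4 * b) \<and> w = (s - 1) / (b * (s + 1))"
    using d(1) assms unfolding d(3) w unfolding d(2)
    by (simp add: field_simps power2_eq_square)
qed

lemma second_order_solutionsI:
  assumes "q \<noteq> 0" "b \<noteq> 0"
    and "\<And>z. z \<in> I \<Longrightarrow> v differentiable (at z)"
    and d: "\<And>z. z \<in> I \<Longrightarrow> (deriv v has_real_derivative d z) (at z)"
    and "\<And>z. z \<in> I \<Longrightarrow> s z \<noteq> - 1"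
    and "\<And>z. z \<in> I \<Longrightarrow> deriv v z = q * (1 - (s z)\<^sup>2) / (4 * b)"
    and "\<And>z. z \<in> I \<Longrightarrow> d z = deriv v z + (s z - 1) / (b * (s z + 1))"
  shows "v \<in> second_order_solutions q b I"
proof -
  have "v differentiable (at z) \<and> deriv v differentiable (at z) \<and>
      1 - b * (deriv (deriv v) z - deriv v z) \<noteq> 0 \<and>
      deriv v z + q * ((deriv (deriv v) z - deriv v z) /
        (1 - b * (deriv (deriv v) z - deriv v z))\<^sup>2) = 0" if "z \<in> I" for z
  proof -
    have "deriv v differentiable (at z)"
      using d[OF that] real_differentiable_def by blast
    moreover have "deriv (deriv v) z = d z"
      using d[OF that] by (rule DERIV_imp_deriv)
    ultimately show ?thesis
      using second_order_parametrization[OF assms(1,2), of "s z" "deriv v z" "d z - deriv v z"]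
        assms(3,5-7)[OF that] by simp
  qed
  then show ?thesis
    unfolding second_order_solutions_def twice_differentiable_on_def by blast
qed

lemma linear_solutions_deriv:
  assumes "open I" "v \<in> linear_solutions m I" "z \<in> I"
  shows "v differentiable (at z)" "deriv v z = m" "(deriv v has_real_derivative 0) (at z)"
proof -
  have v: "\<And>z. z \<in> I \<Longrightarrow> (v has_real_derivative m) (at z)"
    using assms(2) by (simp add: linear_solutions_def)
  then show "v differentiable (at z)" "deriv v z = m"
    using assms(3) real_differentiable_def DERIV_imp_deriv by blast+
  show "(deriv v has_real_derivative 0) (at z)"
    using has_field_derivative_transform_within_open[OF DERIV_const[of m] assms(1,3)]
      DERIV_imp_deriv[OF v] by metis
qed

lemma linear_solutions_second_order:
  assumes "q \<noteq> 0" "b \<noteq> 0" "open I" "v \<in> linear_solutions m I"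
    and "s \<noteq> - 1" "m = q * (1 - s\<^sup>2) / (4 * b)" "m + (s - 1) / (b * (s + 1)) = 0"
  shows "v \<in> second_order_solutions q b I"
  using assms linear_solutions_deriv[OF assms(3,4)]
  by (intro second_order_solutionsI[where s="\<lambda>_. s" and d="\<lambda>_. 0"]) simp_all

text \<open>
  Both implicit equations are instances of one relation \<open>E\<close>, evaluated at \<open>s = p\<close> and at
  \<open>s = - p\<close>.  It is a primitive of the autonomous equation
  \<open>s\<^sub>z = (s - 1) (q (s + 1)\<^sup>2 - 4) / (2 q s (s + 1))\<close>.
\<close>

locale implicit_equation =
  fixes q \<alpha> :: real and G :: "real \<Rightarrow> real" and E :: "real \<Rightarrow> real \<Rightarrow> real \<Rightarrow> bool"
  assumes q_nonzero: "q \<noteq> 0" and \<alpha>_nonzero: "\<alpha> \<noteq> 0"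
    and E_iff: "E s z c \<longleftrightarrow> s \<noteq> 1 \<and> q * (s + 1)\<^sup>2 \<noteq> 4 \<and> G s = \<alpha> * z + c"
    and G_deriv: "s \<noteq> 1 \<Longrightarrow> q * (s + 1)\<^sup>2 \<noteq> 4 \<Longrightarrow>
      (G has_real_derivative \<alpha> * (2 * q * s * (s + 1) / ((s - 1) * (q * (s + 1)\<^sup>2 - 4)))) (at s)"
begin

text \<open>Initially \<open>v\<close> is only known to be differentiable once. The relation
  determines \<open>z\<close> from \<open>s z\<close>, so \<open>deriv v\<close> is injective, hence
  continuous, and so is \<open>s\<close>. After \<open>s = 0\<close> and \<open>s = - 1\<close> are
  excluded, the derivative of \<open>G\<close> does not vanish along \<open>s\<close>; the inverse
  function rule makes \<open>s\<close>, and with it \<open>deriv v\<close>, differentiable.\<close>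

lemma implicit_solutions_second_order:
  assumes b: "b \<noteq> 0" and I: "open I" and \<sigma>: "\<sigma> * \<sigma> = 1"
    and v: "v \<in> implicit_solutions (\<lambda>p. E (\<sigma> * p)) q b I"
  shows "v \<in> second_order_solutions q b I"
proof -
  define s where "s = (\<lambda>z. \<sigma> * p_of q b v z)"
  obtain c where
    dv: "\<And>z. z \<in> I \<Longrightarrow> v differentiable (at z)" and
    rad: "\<And>z. z \<in> I \<Longrightarrow> 0 \<le> 1 - 4 * b / q * deriv v z" and
    Es: "\<And>z. z \<in> I \<Longrightarrow> E (s z) z c"
    using v unfolding implicit_solutions_def s_def by auto
  have s1: "s z \<noteq> 1" and s2: "q * (s z + 1)\<^sup>2 \<noteq> 4" and Gs: "G (s z) = \<alpha> * z + c"
    if "z \<in> I" for z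
    using Es[OF that] by (simp_all add: E_iff)
  have u: "deriv v z = q * (1 - (s z)\<^sup>2) / (4 * b)" if "z \<in> I" for z
  proof -
    have "(s z)\<^sup>2 = (\<sigma> * \<sigma>) * (p_of q b v z)\<^sup>2"
      by (simp add: s_def power2_eq_square)
    also have "\<dots> = 1 - 4 * b / q * deriv v z"
      using rad[OF that] by (simp add: \<sigma> p_of_def)
    finally show ?thesis
      using b q_nonzero by (simp add: field_simps)
  qed
  have der_v: "(v has_real_derivative deriv v z) (at z)" if "z \<in> I" for z
    using dv[OF that] DERIV_deriv_iff_real_differentiable by blast
  have "inj_on (deriv v) I"
  proof (rule inj_onI)
    fix x y assume xy: "x \<in> I" "y \<in> I" "deriv v x = deriv v y"
    then have "s x = s y"
      by (simp add: s_def p_of_def)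
    then have "\<alpha> * x + c = \<alpha> * y + c"
      using Gs[OF xy(1)] Gs[OF xy(2)] by metis
    then show "x = y"
      using \<alpha>_nonzero by simp
  qed
  with I der_v have "isCont (deriv v) z" if "z \<in> I" for z
    using that inj_derivative_isCont by blast
  then have s_cont: "isCont s z" if "z \<in> I" for z
    using that unfolding s_def p_of_def by (intro continuous_intros) auto
  define U where "U = {x::real. x \<noteq> 1} \<inter> {x. q * (x + 1)\<^sup>2 \<noteq> 4}"
  have "open U"
    unfolding U_def by (intro open_Int open_Collect_neq continuous_intros)
  have U: "s z \<in> U" if "z \<in> I" for z
    using s1[OF that] s2[OF that] by (simp add: U_def)
  have s_nz: "s z \<noteq> 0" if "z \<in> I" for z
  proof
    assume s0: "s z = 0"
    \<comment> \<open>At \<open>s = 0\<close> the condition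
      \<open>q * (s + 1)\<^sup>2 \<noteq> 4\<close> reads \<open>q \<noteq> 4\<close>. Thus
      \<open>0\<close> is a simple zero of the derivative of \<open>G\<close>.\<close>
    have q4: "q - 4 \<noteq> 0"
      using s2[OF that] s0 by simp
    show False
    proof (rule no_passage_through_simple_critical_point[OF I that s_cont[OF that]
          \<alpha>_nonzero Gs \<open>open U\<close> U[OF that],
          where h="\<lambda>x. \<alpha> * (2 * q * (x + 1) / ((x - 1) * (q * (x + 1)\<^sup>2 - 4)))"])
      show "(G has_real_derivative (x - s z) *
          (\<alpha> * (2 * q * (x + 1) / ((x - 1) * (q * (x + 1)\<^sup>2 - 4))))) (at x)" if "x \<in> U" for x
        using G_deriv[of x] that by (simp add: s0 U_def mult_ac)
      show "isCont (\<lambda>x. \<alpha> * (2 * q * (x + 1) / ((x - 1) * (q * (x + 1)\<^sup>2 - 4)))) (s z)"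
        unfolding s0 using q4 by (intro continuous_intros) auto
      show "\<alpha> * (2 * q * (s z + 1) / ((s z - 1) * (q * (s z + 1)\<^sup>2 - 4))) \<noteq> 0"
        unfolding s0 using q4 q_nonzero \<alpha>_nonzero by simp
    qed
  qed
  have s_m1: "s z \<noteq> - 1" if "z \<in> I" for z
  proof
    assume s0: "s z = - 1"
    show False
    proof (rule no_passage_through_simple_critical_point[OF I that s_cont[OF that]
          \<alpha>_nonzero Gs \<open>open U\<close> U[OF that],
          where h="\<lambda>x. \<alpha> * (2 * q * x / ((x - 1) * (q * (x + 1)\<^sup>2 - 4)))"])
      show "(G has_real_derivative (x - s z) *
          (\<alpha> * (2 * q * x / ((x - 1) * (q * (x + 1)\<^sup>2 - 4))))) (at x)" if "x \<in> U" for x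
        using G_deriv[of x] that by (simp add: s0 U_def mult_ac)
      show "isCont (\<lambda>x. \<alpha> * (2 * q * x / ((x - 1) * (q * (x + 1)\<^sup>2 - 4)))) (s z)"
        unfolding s0 by (intro continuous_intros) auto
      show "\<alpha> * (2 * q * s z / ((s z - 1) * (q * (s z + 1)\<^sup>2 - 4))) \<noteq> 0"
        unfolding s0 using q_nonzero \<alpha>_nonzero by simp
    qed
  qed
  \<comment> \<open>\<open>D\<close> is the derivative of \<open>G\<close> divided by
    \<open>\<alpha>\<close>, the reciprocal of the right hand side of the autonomous equation. Since
    \<open>(G (s z) - c) / \<alpha> = z\<close>, the map \<open>s\<close> is a local inverse of a
    function with derivative \<open>D\<close>.\<close>
  define D where "D = (\<lambda>x. 2 * q * x * (x + 1) / ((x - 1) * (q * (x + 1)\<^sup>2 - 4)))"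
  have D_nz: "D (s z) \<noteq> 0" if "z \<in> I" for z
    using s1[OF that] s2[OF that] s_nz[OF that] s_m1[OF that] q_nonzero
    by (simp add: D_def add_eq_0_iff2)
  have s_der: "(s has_real_derivative inverse (D (s z))) (at z)" if z: "z \<in> I" for z
  proof -
    obtain e where e: "e > 0" "ball z e \<subseteq> I"
      using I z by (meson open_contains_ball)
    show ?thesis
    proof (rule DERIV_inverse_function[where f="\<lambda>x. (G x - c) / \<alpha>" and a="z - e" and b="z + e"])
      show "((\<lambda>x. (G x - c) / \<alpha>) has_real_derivative D (s z)) (at (s z))"
        using G_deriv[OF s1[OF z] s2[OF z]] \<alpha>_nonzero
        by (auto intro!: derivative_eq_intros simp: D_def)
      show "D (s z) \<noteq> 0"
        using D_nz[OF z] .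
      show "(G (s y) - c) / \<alpha> = y" if "z - e < y" "y < z + e" for y
      proof -
        have "y \<in> ball z e"
          using that by (auto simp: dist_real_def)
        then show ?thesis
          using Gs[of y] e \<alpha>_nonzero by auto
      qed
    qed (use e s_cont[OF z] in auto)
  qed
  show ?thesis
  proof (rule second_order_solutionsI[OF q_nonzero b dv, where s=s])
    fix z assume z: "z \<in> I"
    have "((\<lambda>z. q * (1 - (s z)\<^sup>2) / (4 * b)) has_real_derivative
        - (q * s z * inverse (D (s z)) / (2 * b))) (at z)"
      using s_der[OF z] b by (auto intro!: derivative_eq_intros simp: field_simps)
    then have "(deriv v has_real_derivative - (q * s z * inverse (D (s z)) / (2 * b))) (at z)"
      by (rule has_field_derivative_transform_within_open[OF _ I z]) (simp add: u)
    moreover have "- (q * s z * inverse (D (s z)) / (2 * b)) =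
        deriv v z + (s z - 1) / (b * (s z + 1))"
    proof -
      have "q * s z * inverse (D (s z)) / (2 * b) =
          (s z - 1) * (q * (s z + 1)\<^sup>2 - 4) / (4 * b * (s z + 1))"
        using q_nonzero b s_nz[OF z] by (simp add: D_def)
      also have "\<dots> = - (deriv v z + (s z - 1) / (b * (s z + 1)))"
      proof -
        have "s z + 1 \<noteq> 0"
          using s_m1[OF z] by (simp add: add_eq_0_iff2)
        then show ?thesis
          using b unfolding u[OF z]
          by (simp add: divide_simps power2_eq_square) (simp add: algebra_simps)
      qed
      finally show ?thesis
        by simp
    qed
    ultimately show "(deriv v has_real_derivative deriv v z + (s z - 1) / (b * (s z + 1))) (at z)"
      by simp
  qed (use u s_m1 in auto)
qed

end

section \<open>The implicit relations as primitives for the three ranges of \<open>q\<close>\<close>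

lemma has_real_derivative_ln_abs:
  fixes f :: "real \<Rightarrow> real"
  assumes "(f has_real_derivative d) (at x)" "f x \<noteq> 0"
  shows "((\<lambda>x. ln \<bar>f x\<bar>) has_real_derivative d / f x) (at x)"
proof -
  have "((\<lambda>y. ln \<bar>y\<bar>) has_real_derivative 1 / f x) (at (f x))"
  proof (cases "f x > 0")
    case True
    have "(ln has_real_derivative 1 / f x) (at (f x))"
      using True by (auto intro!: derivative_eq_intros)
    then show ?thesis
      by (rule has_field_derivative_transform_within_open[where S="{0<..}"]) (use True in auto)
  next
    case False
    have "((\<lambda>y. ln (- y)) has_real_derivative 1 / f x) (at (f x))"
      using False assms(2) by (auto intro!: derivative_eq_intros)
    then show ?thesis
      by (rule has_field_derivative_transform_within_open[where S="{..<0}"])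
        (use False assms(2) in auto)
  qed
  from DERIV_chain2[OF this assms(1)] show ?thesis
    by simp
qed

text \<open>For positive \<open>q\<close> the quadratic \<open>q * (s + 1)\<^sup>2 - 4\<close> has
  two real linear factors, so partial fractions give three logarithms. The coefficients are the
  residues after scaling by \<open>2 * (q - 1)\<close>, which is nonzero because
  \<open>q \<noteq> 1\<close>.\<close>

lemma implicit_equation_gt:
  assumes "q > 0" "q \<noteq> 1"
  shows "implicit_equation q (2 * (q - 1)) (\<lambda>s. 2 * q * ln \<bar>s - 1\<bar>
     + (q - sqrt q - 2) * ln \<bar>(s + 1) * sqrt q - 2\<bar>
     + (q + sqrt q - 2) * ln \<bar>(s + 1) * sqrt q + 2\<bar>) (eq_gt_upper q)"
proof
  define r where "r = sqrt q"
  have r: "q = r * r"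
    using assms by (simp add: r_def)
  have fac: "q * (s + 1)\<^sup>2 - 4 = ((s + 1) * r - 2) * ((s + 1) * r + 2)" for s
    by (simp add: r power2_eq_square algebra_simps)
  have ne: "q * (s + 1)\<^sup>2 \<noteq> 4 \<longleftrightarrow> (s + 1) * r - 2 \<noteq> 0 \<and> (s + 1) * r + 2 \<noteq> 0" for s
    using fac[of s] by (metis eq_iff_diff_eq_0 mult_eq_0_iff)
  show "eq_gt_upper q s z c \<longleftrightarrow> s \<noteq> 1 \<and> q * (s + 1)\<^sup>2 \<noteq> 4 \<and>
      2 * q * ln \<bar>s - 1\<bar> + (q - sqrt q - 2) * ln \<bar>(s + 1) * sqrt q - 2\<bar>
        + (q + sqrt q - 2) * ln \<bar>(s + 1) * sqrt q + 2\<bar> = 2 * (q - 1) * z + c" for s z c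
    unfolding eq_gt_upper_def ne r_def by simp
  show "((\<lambda>s. 2 * q * ln \<bar>s - 1\<bar> + (q - sqrt q - 2) * ln \<bar>(s + 1) * sqrt q - 2\<bar>
        + (q + sqrt q - 2) * ln \<bar>(s + 1) * sqrt q + 2\<bar>) has_real_derivative
      2 * (q - 1) * (2 * q * s * (s + 1) / ((s - 1) * (q * (s + 1)\<^sup>2 - 4)))) (at s)"
    if s: "s \<noteq> 1" "q * (s + 1)\<^sup>2 \<noteq> 4" for s
  proof -
    define A B where "A = (s + 1) * r - 2" and "B = (s + 1) * r + 2"
    have nz: "s - 1 \<noteq> 0" "A \<noteq> 0" "B \<noteq> 0"
      using s ne by (auto simp: A_def B_def)
    have *: "((\<lambda>s. 2 * q * ln \<bar>s - 1\<bar> + (q - r - 2) * ln \<bar>(s + 1) * r - 2\<bar>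
        + (q + r - 2) * ln \<bar>(s + 1) * r + 2\<bar>) has_real_derivative
        2 * q * (1 / (s - 1)) + (q - r - 2) * (r / A) + (q + r - 2) * (r / B)) (at s)"
      unfolding A_def B_def
      using nz unfolding A_def B_def
      by (intro DERIV_add DERIV_cmult has_real_derivative_ln_abs)
        (auto intro!: derivative_eq_intros)
    have "2 * q * (1 / (s - 1)) + (q - r - 2) * (r / A) + (q + r - 2) * (r / B) =
        (2 * q * A * B + (s - 1) * ((q - r - 2) * r * B + (q + r - 2) * r * A))
          / ((s - 1) * (A * B))"
      using nz by (simp add: divide_simps) (simp add: algebra_simps)
    also have "2 * q * A * B + (s - 1) * ((q - r - 2) * r * B + (q + r - 2) * r * A) =
        2 * (q - 1) * (2 * q * s * (s + 1))"
      unfolding A_def B_def r by (simp add: algebra_simps)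
    also have "A * B = q * (s + 1)\<^sup>2 - 4"
      using fac[of s] by (simp add: A_def B_def)
    finally show ?thesis
      using * by (simp add: r_def)
  qed
qed (use assms in auto)

text \<open>At \<open>q = 1\<close> one root of the quadratic is \<open>s = 1\<close>. The integrand
  acquires a double pole there, which accounts for the rational term
  \<open>1 / (1 - s)\<close>.\<close>

lemma implicit_equation_one:
  "implicit_equation 1 1 (\<lambda>s. 1 / (1 - s) + 1 / 4 * ln \<bar>(s + 3) ^ 3 * (s - 1) ^ 5\<bar>) eq_one_upper"
proof
  have fac: "1 * (s + 1)\<^sup>2 - 4 = (s + 3) * (s - 1)" for s :: real
    by (simp add: power2_eq_square algebra_simps)
  have ne: "1 * (s + 1)\<^sup>2 \<noteq> 4 \<longleftrightarrow> s + 3 \<noteq> 0 \<and> s - 1 \<noteq> 0" for s :: real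
    using fac[of s] by (metis eq_iff_diff_eq_0 mult_eq_0_iff)
  show "eq_one_upper s z c \<longleftrightarrow> s \<noteq> 1 \<and> 1 * (s + 1)\<^sup>2 \<noteq> 4 \<and>
      1 / (1 - s) + 1 / 4 * ln \<bar>(s + 3) ^ 3 * (s - 1) ^ 5\<bar> = 1 * z + c" for s z c
    unfolding eq_one_upper_def ne by auto
  show "((\<lambda>s. 1 / (1 - s) + 1 / 4 * ln \<bar>(s + 3) ^ 3 * (s - 1) ^ 5\<bar>) has_real_derivative
      1 * (2 * 1 * s * (s + 1) / ((s - 1) * (1 * (s + 1)\<^sup>2 - 4)))) (at s)"
    if s: "s \<noteq> 1" "1 * (s + 1)\<^sup>2 \<noteq> 4" for s :: real
  proof -
    define A B where "A = s + 3" and "B = s - 1"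
    have nz: "A \<noteq> 0" "B \<noteq> 0"
      using s ne by (auto simp: A_def B_def)
    have inv: "((\<lambda>s. 1 / (1 - s)) has_real_derivative 1 / B\<^sup>2) (at s)"
      using nz unfolding B_def
      by (auto intro!: derivative_eq_intros simp: power2_eq_square divide_simps)
        (simp add: algebra_simps)
    have "((\<lambda>s. (s + 3) ^ 3 * (s - 1) ^ 5) has_real_derivative
        3 * A\<^sup>2 * B ^ 5 + A ^ 3 * (5 * B ^ 4)) (at s)"
      unfolding A_def B_def by (auto intro!: derivative_eq_intros)
    then have "((\<lambda>s. ln \<bar>(s + 3) ^ 3 * (s - 1) ^ 5\<bar>) has_real_derivative
        (3 * A\<^sup>2 * B ^ 5 + A ^ 3 * (5 * B ^ 4)) / ((s + 3) ^ 3 * (s - 1) ^ 5)) (at s)"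
      by (rule has_real_derivative_ln_abs) (use nz in \<open>simp add: A_def B_def\<close>)
    also have "(3 * A\<^sup>2 * B ^ 5 + A ^ 3 * (5 * B ^ 4)) / ((s + 3) ^ 3 * (s - 1) ^ 5) =
        3 / A + 5 / B"
      using nz unfolding A_def[symmetric] B_def[symmetric]
      by (simp add: divide_simps) (simp add: algebra_simps eval_nat_numeral)
    finally have "((\<lambda>s. 1 / (1 - s) + 1 / 4 * ln \<bar>(s + 3) ^ 3 * (s - 1) ^ 5\<bar>)
        has_real_derivative 1 / B\<^sup>2 + 1 / 4 * (3 / A + 5 / B)) (at s)"
      by (intro DERIV_add inv DERIV_cmult)
    moreover have "1 / B\<^sup>2 + 1 / 4 * (3 / A + 5 / B) =
        2 * s * (s + 1) / ((s - 1) * ((s + 1)\<^sup>2 - 4))"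
    proof -
      have "1 / B\<^sup>2 + 1 / 4 * (3 / A + 5 / B) =
          (4 * A + 3 * B\<^sup>2 + 5 * A * B) / 4 / (B * (A * B))"
        using nz by (simp add: divide_simps power2_eq_square) (simp add: algebra_simps)
      also have "(4 * A + 3 * B\<^sup>2 + 5 * A * B) / 4 = 2 * s * (s + 1)"
        unfolding A_def B_def by (simp add: power2_eq_square algebra_simps)
      also have "A * B = (s + 1)\<^sup>2 - 4"
        using fac[of s] by (simp add: A_def B_def)
      finally show ?thesis
        by (simp add: B_def)
    qed
    ultimately show ?thesis
      by simp
  qed
qed auto

text \<open>For negative \<open>q\<close> the quadratic has no real zero. Its contribution to the
  partial fractions integrates to an arctangent and the logarithm of the quadratic.\<close>

lemma implicit_equation_neg:
  assumes "q < 0"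
  shows "implicit_equation q (2 * (1 - q)) (\<lambda>s. 2 * sqrt (- q) * arctan ((s + 1) * sqrt (- q) / 2)
     - 2 * q * ln \<bar>s - 1\<bar> + (2 - q) * ln \<bar>4 - q * (s + 1)\<^sup>2\<bar>) (eq_neg_upper q)"
proof
  define r where "r = sqrt (- q)"
  have r: "r * r = - q"
    using assms by (simp add: r_def)
  have pos: "4 - q * (s + 1)\<^sup>2 > 0" for s
    using assms by (smt (verit) mult_nonpos_nonneg zero_le_power2)
  show "eq_neg_upper q s z c \<longleftrightarrow> s \<noteq> 1 \<and> q * (s + 1)\<^sup>2 \<noteq> 4 \<and>
      2 * sqrt (- q) * arctan ((s + 1) * sqrt (- q) / 2)
        - 2 * q * ln \<bar>s - 1\<bar> + (2 - q) * ln \<bar>4 - q * (s + 1)\<^sup>2\<bar> = 2 * (1 - q) * z + c" for s z c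
    unfolding eq_neg_upper_def by auto
  show "((\<lambda>s. 2 * sqrt (- q) * arctan ((s + 1) * sqrt (- q) / 2)
        - 2 * q * ln \<bar>s - 1\<bar> + (2 - q) * ln \<bar>4 - q * (s + 1)\<^sup>2\<bar>) has_real_derivative
      2 * (1 - q) * (2 * q * s * (s + 1) / ((s - 1) * (q * (s + 1)\<^sup>2 - 4)))) (at s)"
    if s: "s \<noteq> 1" for s
  proof -
    define A where "A = 4 - q * (s + 1)\<^sup>2"
    have nz: "s - 1 \<noteq> 0" "A \<noteq> 0"
      using s pos[of s] by (auto simp: A_def)
    have A4: "1 + ((s + 1) * r / 2)\<^sup>2 = A / 4"
    proof -
      have "((s + 1) * r)\<^sup>2 = - q * (s + 1)\<^sup>2"
        unfolding power_mult_distrib using r by (simp add: power2_eq_square)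
      then show ?thesis
        by (simp add: A_def power_divide field_simps)
    qed
    have "((\<lambda>s. (s + 1) * r / 2) has_real_derivative r / 2) (at s)"
      by (auto intro!: derivative_eq_intros)
    from DERIV_chain2[OF DERIV_arctan this]
    have arc: "((\<lambda>s. arctan ((s + 1) * r / 2)) has_real_derivative 2 * r / A) (at s)"
      unfolding A4 by (simp add: field_simps)
    have ln1: "((\<lambda>s. ln \<bar>s - 1\<bar>) has_real_derivative 1 / (s - 1)) (at s)"
      using nz by (intro has_real_derivative_ln_abs) (auto intro!: derivative_eq_intros)
    have ln2: "((\<lambda>s. ln \<bar>4 - q * (s + 1)\<^sup>2\<bar>) has_real_derivative - (2 * q * (s + 1)) / A) (at s)"
      unfolding A_def using nz unfolding A_def
      by (intro has_real_derivative_ln_abs) (auto intro!: derivative_eq_intros)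
    have *: "((\<lambda>s. 2 * r * arctan ((s + 1) * r / 2)
        - 2 * q * ln \<bar>s - 1\<bar> + (2 - q) * ln \<bar>4 - q * (s + 1)\<^sup>2\<bar>) has_real_derivative
        2 * r * (2 * r / A) - 2 * q * (1 / (s - 1)) + (2 - q) * (- (2 * q * (s + 1)) / A)) (at s)"
      by (intro DERIV_add DERIV_diff DERIV_cmult arc ln1 ln2)
    have "2 * r * (2 * r / A) = 4 * (r * r) / A"
      by simp
    then have "2 * r * (2 * r / A) - 2 * q * (1 / (s - 1)) + (2 - q) * (- (2 * q * (s + 1)) / A) =
        (- 4 * q * (s - 1) - 2 * q * A - (2 - q) * (2 * q * (s + 1)) * (s - 1)) / ((s - 1) * A)"
      unfolding r using nz by (simp add: divide_simps)
    also have "- 4 * q * (s - 1) - 2 * q * A - (2 - q) * (2 * q * (s + 1)) * (s - 1) =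
        - (2 * (1 - q) * (2 * q * s * (s + 1)))"
      unfolding A_def by (simp add: power2_eq_square algebra_simps)
    also have "- (2 * (1 - q) * (2 * q * s * (s + 1))) / ((s - 1) * A) =
        2 * (1 - q) * (2 * q * s * (s + 1) / ((s - 1) * (q * (s + 1)\<^sup>2 - 4)))"
    proof -
      have "(s - 1) * (q * (s + 1)\<^sup>2 - 4) = - ((s - 1) * A)"
        by (simp add: A_def algebra_simps)
      then show ?thesis
        by simp
    qed
    finally show ?thesis
      using * by (simp add: r_def)
  qed
qed (use assms in auto)

text \<open>Changing the sign of \<open>p\<close> interchanges the two linear factors up to sign,
  which absolute values absorb. For \<open>q = 1\<close> the exponents add up to the even number 8,
  and for negative \<open>q\<close> the arctangent is odd.\<close>

lemma eq_lower_iff_upper: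
  "eq_gt_lower q p z c \<longleftrightarrow> eq_gt_upper q (- p) z c"
  "eq_one_lower p z c \<longleftrightarrow> eq_one_upper (- p) z c"
  "eq_neg_lower q p z c \<longleftrightarrow> eq_neg_upper q (- p) z c"
proof -
  have abs1: "\<bar>- p - 1\<bar> = \<bar>p + 1\<bar>"
    and abs2: "\<bar>(- p + 1) * sqrt q - 2\<bar> = \<bar>(p - 1) * sqrt q + 2\<bar>"
    and abs3: "\<bar>(- p + 1) * sqrt q + 2\<bar> = \<bar>(p - 1) * sqrt q - 2\<bar>"
    by (simp_all add: abs_if algebra_simps)
  have nz1: "- p - 1 \<noteq> 0 \<longleftrightarrow> p + 1 \<noteq> 0"
    and nz2: "(- p + 1) * sqrt q - 2 \<noteq> 0 \<longleftrightarrow> (p - 1) * sqrt q + 2 \<noteq> 0"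
    and nz3: "(- p + 1) * sqrt q + 2 \<noteq> 0 \<longleftrightarrow> (p - 1) * sqrt q - 2 \<noteq> 0"
    using abs1 abs2 abs3 by (metis abs_eq_0)+
  show "eq_gt_lower q p z c \<longleftrightarrow> eq_gt_upper q (- p) z c"
    unfolding eq_gt_lower_def eq_gt_upper_def abs1 abs2 abs3 nz1 nz2 nz3 by auto
  have pw: "(- p + 3) ^ 3 * (- p - 1) ^ 5 = (p - 3) ^ 3 * (p + 1) ^ 5"
    by (simp add: eval_nat_numeral algebra_simps)
  show "eq_one_lower p z c \<longleftrightarrow> eq_one_upper (- p) z c"
    unfolding eq_one_lower_def eq_one_upper_def pw by (auto simp: add.commute)
  have sq: "(- p + 1)\<^sup>2 = (p - 1)\<^sup>2"
    by (simp add: power2_eq_square algebra_simps)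
  have "- p + 1 = - (p - 1)"
    by simp
  then have "(- p + 1) * sqrt (- q) / 2 = - ((p - 1) * sqrt (- q) / 2)"
    by (simp only: mult_minus_left divide_minus_left)
  then have at: "arctan ((- p + 1) * sqrt (- q) / 2) = - arctan ((p - 1) * sqrt (- q) / 2)"
    by (simp only: arctan_minus)
  have abs4: "\<bar>1 + p\<bar> = \<bar>p + 1\<bar>"
    by (simp add: add.commute)
  show "eq_neg_lower q p z c \<longleftrightarrow> eq_neg_upper q (- p) z c"
    unfolding eq_neg_lower_def eq_neg_upper_def sq at nz1 abs1 abs4 by (auto simp: add.commute)
qed

text \<open>The case distinction on \<open>q\<close> is made here once; both inclusions then argue
  only from the locale, with the two implicit families as the values of one relation at
  \<open>p\<close> and \<open>- p\<close>.\<close>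

lemma first_order_solutions_unified:
  assumes "q \<noteq> 0"
  obtains \<alpha> G E where "implicit_equation q \<alpha> G E"
    and "\<And>b I. first_order_solutions q b I = linear_solutions 0 I \<union>
     (if q > 0 then linear_solutions ((- 1 + sqrt q) / b) I \<union>
                    linear_solutions ((- 1 - sqrt q) / b) I else {}) \<union>
     (implicit_solutions E q b I \<union> implicit_solutions (\<lambda>p. E (- p)) q b I)"
proof -
  have lower: "eq_gt_lower q = (\<lambda>p. eq_gt_upper q (- p))" "eq_one_lower = (\<lambda>p. eq_one_upper (- p))"
    "eq_neg_lower q = (\<lambda>p. eq_neg_upper q (- p))"
    by (simp_all add: fun_eq_iff eq_lower_iff_upper)
  consider "q < 0" | "q = 1" | "q > 0" "q \<noteq> 1"
    using assms by linarith
  then show ?thesis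
  proof cases
    case 1
    then show ?thesis
      using implicit_equation_neg[OF 1] that by (simp add: first_order_solutions_def lower)
  next
    case 2
    then show ?thesis
      using implicit_equation_one that by (simp add: first_order_solutions_def lower)
  next
    case 3
    then show ?thesis
      using implicit_equation_gt[OF 3] that by (simp add: first_order_solutions_def lower)
  qed
qed

lemma first_order_subset_second_order:
  assumes "q \<noteq> 0" "b \<noteq> 0" "open I"
  shows "first_order_solutions q b I \<subseteq> second_order_solutions q b I"
proof
  fix v assume "v \<in> first_order_solutions q b I"
  obtain \<alpha> G E where "implicit_equation q \<alpha> G E"
    and first: "\<And>b I. first_order_solutions q b I = linear_solutions 0 I \<union>
     (if q > 0 then linear_solutions ((- 1 + sqrt q) / b) I \<union>
                    linear_solutions ((- 1 - sqrt q) / b) I else {}) \<union>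
     (implicit_solutions E q b I \<union> implicit_solutions (\<lambda>p. E (- p)) q b I)"
    using first_order_solutions_unified[OF assms(1)] by blast
  interpret implicit_equation q \<alpha> G E by fact
  have lin: "v \<in> second_order_solutions q b I"
    if "v \<in> linear_solutions ((- 1 + \<sigma> * sqrt q) / b) I" "\<sigma> * \<sigma> = 1" "q > 0" for \<sigma>
  proof -
    define r where "r = \<sigma> * sqrt q"
    have "r * r = (\<sigma> * \<sigma>) * (sqrt q * sqrt q)"
      unfolding r_def by (simp only: mult_ac)
    then have r: "q = r * r" "r \<noteq> 0"
      using that by auto
    have v: "v \<in> linear_solutions ((- 1 + r) / b) I"
      using that(1) by (simp add: r_def)
    show ?thesis
      \<comment> \<open>The constant parameter is a root of \<open>q * (s + 1)\<^sup>2 = 4\<close>,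
        that is \<open>s + 1 = 2 / r\<close> with \<open>r\<close> either square root of
        \<open>q\<close>.\<close>
      by (rule linear_solutions_second_order[OF assms v, of "- 1 + 2 / r"])
        (use r assms in \<open>simp_all add: field_simps power2_eq_square\<close>)
  qed
  consider "v \<in> linear_solutions 0 I"
    | "q > 0" "v \<in> linear_solutions ((- 1 + sqrt q) / b) I"
    | "q > 0" "v \<in> linear_solutions ((- 1 - sqrt q) / b) I"
    | "v \<in> implicit_solutions E q b I" | "v \<in> implicit_solutions (\<lambda>p. E (- p)) q b I"
    using \<open>v \<in> first_order_solutions q b I\<close> unfolding first by (auto split: if_splits)
  then show "v \<in> second_order_solutions q b I"
  proof cases
    case 1
    then show ?thesis
      using linear_solutions_second_order[OF assms, of v 0 1] by simp
  next
    case 2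
    then show ?thesis
      using lin[of 1] by simp
  next
    case 3
    then show ?thesis
      using lin[of "- 1"] by simp
  next
    case 4
    then show ?thesis
      using implicit_solutions_second_order[OF assms(2,3), of 1] by simp
  next
    case 5
    then show ?thesis
      using implicit_solutions_second_order[OF assms(2,3), of "- 1"] by simp
  qed
qed

section \<open>From the second order equation to the first order equations\<close>

lemma second_order_solutionsE:
  assumes "q \<noteq> 0" "b \<noteq> 0" "v \<in> second_order_solutions q b I"
  obtains s where
    "\<And>z. z \<in> I \<Longrightarrow> s z \<noteq> - 1"
    "\<And>z. z \<in> I \<Longrightarrow> deriv v z = q * (1 - (s z)\<^sup>2) / (4 * b)"
    "\<And>z. z \<in> I \<Longrightarrow> (v has_real_derivative deriv v z) (at z)"
    "\<And>z. z \<in> I \<Longrightarrow>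
      (deriv v has_real_derivative deriv v z + (s z - 1) / (b * (s z + 1))) (at z)"
proof -
  define w s where "w z = deriv (deriv v) z - deriv v z"
    and "s z = 2 / (1 - b * w z) - 1" for z
  have diff: "v differentiable (at z)" "deriv v differentiable (at z)"
    and eq: "1 - b * w z \<noteq> 0 \<and> deriv v z + q * (w z / (1 - b * w z)\<^sup>2) = 0" if "z \<in> I" for z
    using assms(3) that unfolding second_order_solutions_def twice_differentiable_on_def w_def
    by auto
  have *: "s z \<noteq> - 1 \<and> deriv v z = q * (1 - (s z)\<^sup>2) / (4 * b) \<and> w z = (s z - 1) / (b * (s z + 1))"
    if "z \<in> I" for z
    using eq[OF that] s_def[of z] second_order_parametrization[OF assms(1,2)] by blast
  show thesis
  proof
    fix z assume z: "z \<in> I"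
    show "s z \<noteq> - 1" "deriv v z = q * (1 - (s z)\<^sup>2) / (4 * b)"
      using *[OF z] by auto
    show "(v has_real_derivative deriv v z) (at z)"
      using diff[OF z] DERIV_deriv_iff_real_differentiable by blast
    have "deriv (deriv v) z = deriv v z + (s z - 1) / (b * (s z + 1))"
      using *[OF z] by (simp add: w_def)
    then show "(deriv v has_real_derivative deriv v z + (s z - 1) / (b * (s z + 1))) (at z)"
      using diff[OF z] DERIV_deriv_iff_real_differentiable by metis
  qed
qed

text \<open>
  The parameter \<open>s\<close> satisfies \<open>p = \<bar>s\<bar>\<close>, and its sign tells which of the two values of
  \<open>v\<^sub>z\<^sub>z\<close> is taken.
\<close>

locale second_order_solution =
  fixes q b :: real and I :: "real set" and v s :: "real \<Rightarrow> real"
  assumes q: "q \<noteq> 0" and b: "b \<noteq> 0" and open_I: "open I" and interval_I: "is_interval I"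
    and s_neq_m1: "z \<in> I \<Longrightarrow> s z \<noteq> - 1"
    and u_eq: "z \<in> I \<Longrightarrow> deriv v z = q * (1 - (s z)\<^sup>2) / (4 * b)"
    and der_v: "z \<in> I \<Longrightarrow> (v has_real_derivative deriv v z) (at z)"
    and der_u: "z \<in> I \<Longrightarrow>
      (deriv v has_real_derivative deriv v z + (s z - 1) / (b * (s z + 1))) (at z)"
begin

lemma s_squared: "z \<in> I \<Longrightarrow> (s z)\<^sup>2 = 1 - 4 * b / q * deriv v z"
  using q b by (simp add: u_eq)

lemma p_of_eq: "z \<in> I \<Longrightarrow> p_of q b v z = \<bar>s z\<bar>"
  unfolding p_of_def by (simp only: s_squared[symmetric] real_sqrt_abs)

lemma isCont_p: "z \<in> I \<Longrightarrow> isCont (p_of q b v) z"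
  unfolding p_of_def using DERIV_isCont[OF der_u] by (intro continuous_intros) auto

text \<open>
  \<open>v\<^sub>z\<^sub>z - v\<^sub>z = (s - 1) / (b (s + 1))\<close> is the derivative of \<open>v\<^sub>z - v\<close>, so it has the intermediate
  value property.  Hence \<open>s + 1\<close> does not change sign, and \<open>s\<close> does so only at zeros.
\<close>

lemma der_u_minus_v:
  assumes "z \<in> I"
  shows "((\<lambda>z. b * (deriv v z - v z)) has_real_derivative 1 - 2 / (s z + 1)) (at z)"
proof -
  have "s z + 1 \<noteq> 0"
    using s_neq_m1[OF assms] by (simp add: add_eq_0_iff2)
  then have "(s z - 1) / (s z + 1) = 1 - 2 / (s z + 1)"
    by (simp add: field_simps)
  then have "b * ((s z - 1) / (b * (s z + 1))) = 1 - 2 / (s z + 1)"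
    using b by simp
  then show ?thesis
    using DERIV_cmult[OF DERIV_diff[OF der_u[OF assms] der_v[OF assms]], of b] by simp
qed

lemma s_side: "(\<forall>z\<in>I. s z > - 1) \<or> (\<forall>z\<in>I. s z < - 1)"
proof -
  have "(\<forall>z\<in>I. 2 / (s z + 1) > 0) \<or> (\<forall>z\<in>I. 2 / (s z + 1) < 0)"
  proof (rule deriv_nonzero_constant_sign[OF interval_I])
    fix z assume z: "z \<in> I"
    show "((\<lambda>z. z - b * (deriv v z - v z)) has_real_derivative 2 / (s z + 1)) (at z)"
      using DERIV_diff[OF DERIV_ident der_u_minus_v[OF z]] by simp
    show "2 / (s z + 1) \<noteq> 0"
      using s_neq_m1[OF z] by (simp add: add_eq_0_iff2)
  qed
  then show ?thesis
    by (auto simp: zero_less_divide_iff divide_less_0_iff)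
qed

lemma s_sign:
  assumes "J \<subseteq> I" "is_interval J" and nz: "\<And>z. z \<in> J \<Longrightarrow> s z \<noteq> 0"
  shows "(\<forall>z\<in>J. s z > 0) \<or> (\<forall>z\<in>J. s z < 0)"
  using s_side
proof
  assume gt: "\<forall>z\<in>I. s z > - 1"
  have pos: "s z + 1 > 0" if "z \<in> J" for z
    using bspec[OF gt, of z] that assms(1) by (simp add: subset_iff)
  \<comment> \<open>The left side is the derivative of \<open>z + b * (deriv v z - v z)\<close>. As
    \<open>s z + 1\<close> is positive, it has the sign of \<open>s z\<close>.\<close>
  have eq: "1 + (1 - 2 / (s z + 1)) = 2 * s z / (s z + 1)" if "z \<in> J" for z
    using pos[OF that] by (simp add: field_simps)
  have "(\<forall>z\<in>J. 2 * s z / (s z + 1) > 0) \<or> (\<forall>z\<in>J. 2 * s z / (s z + 1) < 0)"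
  proof (rule deriv_nonzero_constant_sign[OF assms(2)])
    fix z assume z: "z \<in> J"
    show "((\<lambda>z. z + b * (deriv v z - v z)) has_real_derivative 2 * s z / (s z + 1)) (at z)"
      using DERIV_add[OF DERIV_ident der_u_minus_v] z assms(1) by (metis eq subsetD)
    show "2 * s z / (s z + 1) \<noteq> 0"
      using nz[OF z] pos[OF z] by simp
  qed
  then show ?thesis
  proof
    assume *: "\<forall>z\<in>J. 2 * s z / (s z + 1) > 0"
    have "s z > 0" if "z \<in> J" for z
      using *[rule_format, OF that] pos[OF that] by (simp add: zero_less_divide_iff)
    then show ?thesis
      by blast
  next
    assume *: "\<forall>z\<in>J. 2 * s z / (s z + 1) < 0"
    have "s z < 0" if "z \<in> J" for z
      using *[rule_format, OF that] pos[OF that] by (simp add: divide_less_0_iff)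
    then show ?thesis
      by blast
  qed
next
  assume lt: "\<forall>z\<in>I. s z < - 1"
  have "s z < 0" if "z \<in> J" for z
    using lt that assms(1) by (smt (verit) subsetD)
  then show ?thesis
    by blast
qed

lemma s_eq_signed_p:
  assumes "J \<subseteq> I" "is_interval J" "\<And>z. z \<in> J \<Longrightarrow> s z \<noteq> 0"
  obtains \<sigma> where "\<sigma> = 1 \<or> \<sigma> = - 1" "\<And>z. z \<in> J \<Longrightarrow> s z = \<sigma> * p_of q b v z"
  using s_sign[OF assms]
proof
  assume "\<forall>z\<in>J. s z > 0"
  then have "s z = 1 * p_of q b v z" if "z \<in> J" for z
    using that p_of_eq[OF subsetD[OF assms(1) that]] by auto
  then show ?thesis
    using that by blast
next
  assume "\<forall>z\<in>J. s z < 0"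
  then have "s z = - 1 * p_of q b v z" if "z \<in> J" for z
    using that p_of_eq[OF subsetD[OF assms(1) that]] by auto
  then show ?thesis
    using that by blast
qed

text \<open>Continuity of \<open>s\<close> is not yet available, but that of \<open>p_of\<close>,
  which equals the absolute value of \<open>s\<close>, suffices.\<close>

lemma nonzero_neighbourhood:
  assumes "z \<in> I" "s z \<noteq> 0"
  obtains e where "e > 0" "ball z e \<subseteq> I" "\<And>y. y \<in> ball z e \<Longrightarrow> s y \<noteq> 0"
proof -
  have "p_of q b v z > 0"
    using assms by (simp add: p_of_eq)
  with isCont_p[OF assms(1)] have "\<forall>\<^sub>F y in at z. p_of q b v y > 0"
    unfolding isCont_def by (rule order_tendstoD)
  then obtain S where S: "open S" "z \<in> S" "\<And>y. y \<in> S \<Longrightarrow> y \<noteq> z \<Longrightarrow> p_of q b v y > 0"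
    unfolding eventually_at_topological by blast
  obtain e where e: "e > 0" "ball z e \<subseteq> I \<inter> S"
    using S open_I assms(1) by (meson IntI open_Int open_contains_ball)
  show thesis
  proof
    show "s y \<noteq> 0" if "y \<in> ball z e" for y
    proof (cases "y = z")
      case False
      have "y \<in> I" "y \<in> S"
        using e that by auto
      then show ?thesis
        using S(3)[of y] False by (auto simp: p_of_eq)
    qed (use assms in simp)
  qed (use e in auto)
qed

text \<open>At a zero of \<open>s\<close> its absolute value \<open>p_of\<close> tends to zero.
  Elsewhere \<open>s\<close> is locally a constant sign times the continuous
  \<open>p_of\<close>.\<close>

lemma isCont_s:
  assumes "z \<in> I"
  shows "isCont s z"
proof (cases "s z = 0")
  case True
  have "(p_of q b v \<longlongrightarrow> 0) (at z)"
    using isCont_p[OF assms] True assms by (simp add: isCont_def p_of_eq)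
  moreover have "\<forall>\<^sub>F y in at z. p_of q b v y = \<bar>s y\<bar>"
    using open_I assms p_of_eq unfolding eventually_at_topological by blast
  ultimately have "((\<lambda>y. \<bar>s y\<bar>) \<longlongrightarrow> 0) (at z)"
    by (rule Lim_transform_eventually)
  then show ?thesis
    using True by (simp add: isCont_def tendsto_rabs_zero_iff)
next
  case False
  obtain e where e: "e > 0" "ball z e \<subseteq> I" "\<And>y. y \<in> ball z e \<Longrightarrow> s y \<noteq> 0"
    using nonzero_neighbourhood[OF assms False] by blast
  obtain \<sigma> where s: "\<And>y. y \<in> ball z e \<Longrightarrow> s y = \<sigma> * p_of q b v y"
    using s_eq_signed_p[OF e(2) is_interval_ball_real e(3)] by blast
  have "continuous_on (ball z e) (\<lambda>y. \<sigma> * p_of q b v y)"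
    using e(2) isCont_p by (intro continuous_intros continuous_at_imp_continuous_on) auto
  then have "continuous_on (ball z e) s"
    by (rule continuous_on_eq) (simp add: s)
  then show ?thesis
    using e(1) by (simp add: continuous_on_eq_continuous_at)
qed

text \<open>The factors exhibit the stationary values of \<open>deriv v\<close>:
  \<open>s = 1\<close> yields slope zero, and \<open>q * (s + 1)\<^sup>2 = 4\<close> the other two
  slopes.\<close>

lemma der_u_factored:
  assumes "z \<in> I"
  shows "deriv v z + (s z - 1) / (b * (s z + 1)) =
    - ((s z - 1) * (q * (s z + 1)\<^sup>2 - 4) / (4 * b * (s z + 1)))"
proof -
  have "s z + 1 \<noteq> 0"
    using s_neq_m1[OF assms] by (simp add: add_eq_0_iff2)
  then show ?thesis
    using b unfolding u_eq[OF assms]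
    by (simp add: divide_simps power2_eq_square) (simp add: algebra_simps)
qed

text \<open>Locally \<open>s\<close> is a fixed sign times the square root of
  \<open>1 - 4 * b / q * deriv v z\<close>, whose radicand is positive where \<open>s\<close> does
  not vanish, so the chain rule applies.\<close>

lemma der_s:
  assumes "z \<in> I" "s z \<noteq> 0"
  shows "(s has_real_derivative (s z - 1) * (q * (s z + 1)\<^sup>2 - 4) / (2 * q * s z * (s z + 1))) (at z)"
proof -
  obtain e where e: "e > 0" "ball z e \<subseteq> I" "\<And>y. y \<in> ball z e \<Longrightarrow> s y \<noteq> 0"
    using nonzero_neighbourhood[OF assms] by blast
  obtain \<sigma> where \<sigma>: "\<sigma> = 1 \<or> \<sigma> = - 1" and s: "\<And>y. y \<in> ball z e \<Longrightarrow> s y = \<sigma> * p_of q b v y"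
    using s_eq_signed_p[OF e(2) is_interval_ball_real e(3)] by blast
  define d where "d = deriv v z + (s z - 1) / (b * (s z + 1))"
  have "((\<lambda>y. 1 - 4 * b / q * deriv v y) has_real_derivative 0 - 4 * b / q * d) (at z)"
    using der_u[OF assms(1)] unfolding d_def by (intro DERIV_diff DERIV_const DERIV_cmult)
  moreover have pos: "0 < 1 - 4 * b / q * deriv v z"
    using s_squared[OF assms(1)] assms(2) by (metis zero_less_power2)
  ultimately have "((\<lambda>y. \<sigma> * sqrt (1 - 4 * b / q * deriv v y)) has_real_derivative
      \<sigma> * (inverse (sqrt (1 - 4 * b / q * deriv v z)) / 2 * (0 - 4 * b / q * d))) (at z)"
    by (intro DERIV_cmult DERIV_chain2[of sqrt] DERIV_real_sqrt)
  then have "(s has_real_derivative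
      \<sigma> * (inverse (sqrt (1 - 4 * b / q * deriv v z)) / 2 * (0 - 4 * b / q * d))) (at z)"
    by (rule has_field_derivative_transform_within_open[where S="ball z e"])
      (use e s in \<open>simp_all add: p_of_def\<close>)
  moreover have "\<sigma> * (inverse (sqrt (1 - 4 * b / q * deriv v z)) / 2 * (0 - 4 * b / q * d)) =
      - (2 * b * d / (q * s z))"
    using \<sigma> s[of z] e(1) q by (auto simp: p_of_def field_simps)
  moreover have "- (2 * b * d / (q * s z)) =
      (s z - 1) * (q * (s z + 1)\<^sup>2 - 4) / (2 * q * s z * (s z + 1))"
  proof -
    have "- (2 * b * - (x / (4 * b * t)) / (q * s z)) = x / (2 * q * s z * t)" for x t
      using b by (simp add: field_simps)
    then show ?thesis
      unfolding d_def der_u_factored[OF assms(1)] .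
  qed
  ultimately show ?thesis
    by simp
qed

text \<open>\<open>F (s z)\<close>, the numerator of the autonomous equation, itself satisfies a
  homogeneous linear equation along the solution, so it vanishes everywhere or nowhere on
  \<open>J\<close>. In the first case \<open>deriv v\<close> is constant; in the second, separation
  of variables makes \<open>G (s z) - \<alpha> * z\<close> constant.\<close>

lemma first_order_where_nonzero:
  assumes "J \<subseteq> I" "open J" "is_interval J" and nz: "\<And>z. z \<in> J \<Longrightarrow> s z \<noteq> 0"
  shows "v \<in> first_order_solutions q b J"
proof -
  obtain \<alpha> G E where "implicit_equation q \<alpha> G E"
    and first: "\<And>b I. first_order_solutions q b I = linear_solutions 0 I \<union>
     (if q > 0 then linear_solutions ((- 1 + sqrt q) / b) I \<union>
                    linear_solutions ((- 1 - sqrt q) / b) I else {}) \<union>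
     (implicit_solutions E q b I \<union> implicit_solutions (\<lambda>p. E (- p)) q b I)"
    using first_order_solutions_unified[OF q] by blast
  interpret implicit_equation q \<alpha> G E by fact
  have convJ: "convex J"
    using assms(3) by (simp add: is_interval_convex_1)
  have J: "z \<in> I" "s z \<noteq> 0" "s z + 1 \<noteq> 0" if "z \<in> J" for z
    using assms(1) nz s_neq_m1[of z] that by (auto simp: add_eq_0_iff2)
  define F where "F x = (x - 1) * (q * (x + 1)\<^sup>2 - 4)" for x
  define F' where "F' x = (q * (x + 1)\<^sup>2 - 4) + (x - 1) * (2 * q * (x + 1))" for x
  \<comment> \<open>By the chain rule \<open>F (s z)\<close> has derivative \<open>F' (s z)\<close>
    times \<open>F (s z) / (2 * q * s z * (s z + 1))\<close>, and \<open>a\<close> is the factor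
    multiplying \<open>F (s z)\<close>.\<close>
  define a where "a z = F' (s z) / (2 * q * s z * (s z + 1))" for z
  have cont_s: "continuous_on J s"
    using J isCont_s by (intro continuous_at_imp_continuous_on) blast
  have cont_a: "continuous_on J a"
    unfolding a_def F'_def using q J cont_s by (intro continuous_intros) auto
  have der_F: "((\<lambda>z. F (s z)) has_real_derivative a z * F (s z)) (at z)" if "z \<in> J" for z
  proof -
    have "(F has_real_derivative F' (s z)) (at (s z))"
      unfolding F_def F'_def by (auto intro!: derivative_eq_intros simp: algebra_simps)
    from DERIV_chain2[OF this der_s[OF J(1,2)[OF that]]] show ?thesis
      by (simp add: a_def F_def)
  qed
  show ?thesis
  proof (cases "\<exists>z\<in>J. F (s z) = 0")
    case True
    then obtain z0 where z0: "z0 \<in> J" "F (s z0) = 0"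
      by blast
    have F0: "F (s z) = 0" if "z \<in> J" for z
      using linear_ode_zero[OF assms(3) der_F cont_a z0 that] .
    have "(deriv v has_real_derivative 0) (at z)" if "z \<in> J" for z
    proof -
      have "deriv v z + (s z - 1) / (b * (s z + 1)) = 0"
        unfolding der_u_factored[OF J(1)[OF that]] using F0[OF that] by (simp add: F_def)
      then show ?thesis
        using der_u[OF J(1)[OF that]] by metis
    qed
    then have "\<exists>c. \<forall>z\<in>J. deriv v z = c"
      by (intro has_field_derivative_zero_constant[OF convJ])
        (simp add: has_field_derivative_at_within)
    then have "deriv v z = deriv v z0" if "z \<in> J" for z
      using that z0(1) by metis
    then have lin: "v \<in> linear_solutions (deriv v z0) J"
      using der_v J unfolding linear_solutions_def by force
    have "s z0 = 1 \<or> q * (s z0 + 1)\<^sup>2 = 4"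
      using z0(2) by (simp add: F_def)
    then show ?thesis
    proof
      assume "s z0 = 1"
      then show ?thesis
        using lin u_eq[OF J(1)[OF z0(1)]] by (simp add: first)
    next
      assume 4: "q * (s z0 + 1)\<^sup>2 = 4"
      then have "q > 0"
        by (smt (verit) mult_nonpos_nonneg zero_le_power2)
      \<comment> \<open>This is a square root of \<open>q\<close> carrying the sign of
        \<open>s z0 + 1\<close>, which decides between the two slopes.\<close>
      define r where "r = 2 / (s z0 + 1)"
      have r: "r * r = q" "r \<noteq> 0"
      proof -
        have "r * r = 4 / (s z0 + 1)\<^sup>2"
          by (simp add: r_def power2_eq_square)
        then show "r * r = q"
          using 4 J(3)[OF z0(1)] by (simp add: divide_eq_eq)
      qed (use J(3)[OF z0(1)] in \<open>simp add: r_def\<close>)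
      have sz0: "s z0 = 2 / r - 1"
        using J(3)[OF z0(1)] by (simp add: r_def add_divide_distrib)
      have "deriv v z0 = (- 1 + r) / b"
        unfolding u_eq[OF J(1)[OF z0(1)]] sz0 r(1)[symmetric] using r(2) b
        by (simp add: field_simps power2_eq_square)
      moreover have "r = sqrt q \<or> r = - sqrt q"
        unfolding r(1)[symmetric] by (simp add: abs_if)
      ultimately have "deriv v z0 = (- 1 + sqrt q) / b \<or> deriv v z0 = (- 1 - sqrt q) / b"
        by auto
      then show ?thesis
        unfolding first using lin \<open>q > 0\<close> by auto
    qed
  next
    case False
    have "((\<lambda>z. G (s z) - \<alpha> * z) has_real_derivative 0) (at z)" if "z \<in> J" for z
    proof -
      have ne: "s z \<noteq> 1" "q * (s z + 1)\<^sup>2 - 4 \<noteq> 0"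
        using False that by (auto simp: F_def)
      then have "(G has_real_derivative
          \<alpha> * (2 * q * s z * (s z + 1) / ((s z - 1) * (q * (s z + 1)\<^sup>2 - 4)))) (at (s z))"
        by (intro G_deriv) auto
      from DERIV_diff[OF DERIV_chain2[OF this der_s[OF J(1,2)[OF that]]]
          DERIV_cmult[OF DERIV_ident, of \<alpha>]]
      show ?thesis
        using ne J(2,3)[OF that] q by simp
    qed
    then have "\<exists>c. \<forall>z\<in>J. G (s z) - \<alpha> * z = c"
      by (intro has_field_derivative_zero_constant[OF convJ])
        (simp add: has_field_derivative_at_within)
    then obtain c where c: "\<And>z. z \<in> J \<Longrightarrow> G (s z) - \<alpha> * z = c"
      by blast
    have E: "E (s z) z c" if "z \<in> J" for z
      using False c[OF that] that by (auto simp: E_iff F_def)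
    obtain \<sigma> where \<sigma>: "\<sigma> = 1 \<or> \<sigma> = - 1" and s: "\<And>y. y \<in> J \<Longrightarrow> s y = \<sigma> * p_of q b v y"
      using s_eq_signed_p[OF assms(1,3) nz] by blast
    have "v differentiable (at z) \<and> 0 \<le> 1 - 4 * b / q * deriv v z" if "z \<in> J" for z
      using der_v[OF J(1)[OF that]] s_squared[OF J(1)[OF that]]
      by (metis real_differentiable_def zero_le_power2)
    moreover have "\<forall>z\<in>J. E (\<sigma> * p_of q b v z) z c"
      using E s by simp
    ultimately have "v \<in> implicit_solutions (\<lambda>p. E (\<sigma> * p)) q b J"
      unfolding implicit_solutions_def by blast
    then show ?thesis
      using \<sigma> by (auto simp: first)
  qed
qed

text \<open>At a zero of \<open>s\<close> the function \<open>v\<^sub>z\<close> is extremal, but \<open>v\<^sub>z\<^sub>z = (q - 4) / (4 b)\<close>.\<close>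

lemma s_nonzero:
  assumes "q \<noteq> 4" "z \<in> I"
  shows "s z \<noteq> 0"
proof
  assume s0: "s z = 0"
  obtain e where e: "e > 0" "ball z e \<subseteq> I"
    using open_I assms(2) by (meson open_contains_ball)
  have "((\<lambda>y. 4 * b / q * deriv v y) has_real_derivative
      4 * b / q * (deriv v z + (s z - 1) / (b * (s z + 1)))) (at z)"
    by (intro DERIV_cmult der_u assms)
  moreover have "\<forall>y. \<bar>z - y\<bar> < e \<longrightarrow> 4 * b / q * deriv v y \<le> 4 * b / q * deriv v z"
  proof (intro allI impI)
    fix y assume "\<bar>z - y\<bar> < e"
    then have "y \<in> I"
      using e by (auto simp: dist_real_def)
    then have "0 \<le> 1 - 4 * b / q * deriv v y"
      by (metis s_squared zero_le_power2)
    moreover have "0 = 1 - 4 * b / q * deriv v z"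
      using s_squared[OF assms(2)] s0 by (metis zero_power2)
    ultimately show "4 * b / q * deriv v y \<le> 4 * b / q * deriv v z"
      by linarith
  qed
  ultimately have "4 * b / q * (deriv v z + (s z - 1) / (b * (s z + 1))) = 0"
    using DERIV_local_max e(1) by blast
  then show False
    using assms(1) q b s0 unfolding der_u_factored[OF assms(2)] by simp
qed

end

lemma second_order_subset_first_order:
  assumes "q \<noteq> 0" "q \<noteq> 4" "b \<noteq> 0" "open I" "is_interval I"
  shows "second_order_solutions q b I \<subseteq> first_order_solutions q b I"
proof
  fix v assume v: "v \<in> second_order_solutions q b I"
  obtain s where "second_order_solution q b I v s"
    using second_order_solutionsE[OF assms(1,3) v] assms
    unfolding second_order_solution_def by metis
  then interpret second_order_solution q b I v s .
  show "v \<in> first_order_solutions q b I"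
    by (rule first_order_where_nonzero) (use assms s_nonzero in auto)
qed

section \<open>The exceptional value \<open>q = 4\<close>\<close>

text \<open>An interval lies between an open interval and the closed one with the same endpoints, so
  its frontier consists of at most these endpoints. This bounds the number of junction
  points.\<close>

lemma finite_frontier_interval:
  fixes S :: "real set"
  assumes "is_interval S"
  shows "finite (frontier S)"
proof -
  obtain a b where S: "S = {} \<or> S = UNIV \<or> S = {..<b} \<or> S = {..b} \<or> S = {a<..} \<or> S = {a..} \<or>
      S = {a<..<b} \<or> S = {a<..b} \<or> S = {a..<b} \<or> S = {a..b}"
    using interval_cases[of S] assms unfolding is_interval_1 by metis
  have fr: "frontier S \<subseteq> A - B" if "closed A" "open B" "S \<subseteq> A" "B \<subseteq> S" for A B
    using closure_minimal[OF that(3,1)] interior_maximal[OF that(4,2)]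
    unfolding frontier_def by blast
  have "frontier S \<subseteq> {a, b}" if "S \<subseteq> {a..b}" "{a<..<b} \<subseteq> S"
    using fr[OF _ _ that] by force
  moreover have "frontier S \<subseteq> {a, b}" if "S \<subseteq> {a..}" "{a<..} \<subseteq> S"
    using fr[OF _ _ that] by force
  moreover have "frontier S \<subseteq> {a, b}" if "S \<subseteq> {..b}" "{..<b} \<subseteq> S"
    using fr[OF _ _ that] by force
  moreover have "frontier S \<subseteq> {a, b}" if "S = {} \<or> S = UNIV"
    using that by auto
  ultimately have "frontier S \<subseteq> {a, b}"
    using S by (elim disjE) (simp_all add: subset_iff)
  then show ?thesis
    by (rule finite_subset) simp
qed

text \<open>
  For \<open>q = 4\<close> the zeros of \<open>s\<close> form an interval: if \<open>b v\<^sub>z\<close> had a local minimum between two of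
  them, then \<open>s = 1\<close>, that is \<open>v\<^sub>z = 0\<close>, at this point and therefore everywhere.
\<close>

context second_order_solution
begin

lemma zeros_is_interval:
  assumes q4: "q = 4"
  shows "is_interval {z \<in> I. s z = 0}"
  unfolding is_interval_1
proof (intro ballI allI impI, elim conjE)
  fix x y m
  assume x: "x \<in> {z \<in> I. s z = 0}" and y: "y \<in> {z \<in> I. s z = 0}" and m: "x \<le> m" "m \<le> y"
  have sub: "{x..y} \<subseteq> I"
    using interval_I x y unfolding is_interval_1
    by (metis (lifting) atLeastAtMost_iff mem_Collect_eq subsetI)
  have bu: "b * deriv v z = 1 - (s z)\<^sup>2" if "z \<in> I" for z
    using u_eq[OF that] b q4 by simp
  show "m \<in> {z \<in> I. s z = 0}"
  proof (rule ccontr)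
    assume "m \<notin> {z \<in> I. s z = 0}"
    then have m_I: "m \<in> I" and "s m \<noteq> 0"
      using m sub by auto
    have cont: "continuous_on {x..y} (\<lambda>z. b * deriv v z)"
      using sub DERIV_isCont[OF der_u]
      by (intro continuous_intros continuous_at_imp_continuous_on) auto
    have "{x..y} \<noteq> {}"
      using m by auto
    \<comment> \<open>For \<open>q = 4\<close> one has
      \<open>b * deriv v z = 1 - (s z)\<^sup>2\<close>, which is maximal exactly at the zeros of
      \<open>s\<close>. As \<open>s m\<close> is nonzero, the minimum is attained strictly between
      \<open>x\<close> and \<open>y\<close>.\<close>
    then obtain n where n: "n \<in> {x..y}" "\<And>z. z \<in> {x..y} \<Longrightarrow> b * deriv v n \<le> b * deriv v z"
      using continuous_attains_inf[OF compact_Icc _ cont] by blast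
    have n_I: "n \<in> I"
      using n(1) sub by blast
    have "b * deriv v n \<le> b * deriv v m"
      using n(2) m by simp
    then have "(s n)\<^sup>2 \<ge> (s m)\<^sup>2"
      using bu[OF n_I] bu[OF m_I] by simp
    then have sn0: "s n \<noteq> 0"
      using \<open>s m \<noteq> 0\<close> by auto
    then have "n \<noteq> x" "n \<noteq> y"
      using x y by auto
    then have "x < n" "n < y"
      using n(1) by auto
    have "((\<lambda>z. b * deriv v z) has_real_derivative
        b * (deriv v n + (s n - 1) / (b * (s n + 1)))) (at n)"
      by (intro DERIV_cmult der_u n_I)
    moreover have "0 < min (n - x) (y - n)"
      using \<open>x < n\<close> \<open>n < y\<close> by simp
    moreover have "\<forall>z. \<bar>n - z\<bar> < min (n - x) (y - n) \<longrightarrow> b * deriv v n \<le> b * deriv v z"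
      by (intro allI impI n(2)) (auto simp: abs_if split: if_splits)
    ultimately have "b * (deriv v n + (s n - 1) / (b * (s n + 1))) = 0"
      by (rule DERIV_local_min)
    then have "(s n - 1) * (q * (s n + 1)\<^sup>2 - 4) = 0"
      using b s_neq_m1[OF n_I] unfolding der_u_factored[OF n_I] by (simp add: add_eq_0_iff2)
    moreover have "q * (s n + 1)\<^sup>2 - 4 = 4 * s n * (s n + 2)"
      by (simp add: q4 power2_eq_square algebra_simps)
    \<comment> \<open>The zero of \<open>s\<close> at \<open>x\<close> selects the side
      \<open>s > - 1\<close> on all of \<open>I\<close>. This rules out \<open>s n = - 2\<close> and
      leaves \<open>s n = 1\<close>.\<close>
    moreover have "s n > - 1"
      using s_side x n_I by fastforce
    ultimately have "s n = 1"
      using sn0 by simp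
    then have un: "deriv v n = 0"
      using u_eq[OF n_I] by simp
    \<comment> \<open>For \<open>q = 4\<close> the equation can be written as a homogeneous linear
      one for \<open>deriv v\<close> with continuous coefficient. Its zero at \<open>n\<close>
      spreads to \<open>x\<close>, where \<open>b * deriv v x = 1\<close>.\<close>
    have der: "(deriv v has_real_derivative (1 - 1 / (s z + 1)\<^sup>2) * deriv v z) (at z)"
      if "z \<in> I" for z
    proof -
      have "s z + 1 \<noteq> 0"
        using s_neq_m1[OF that] by (simp add: add_eq_0_iff2)
      then have "(s z - 1) / (b * (s z + 1)) = - ((1 - (s z)\<^sup>2) / b) / (s z + 1)\<^sup>2"
        using b by (simp add: divide_simps power2_eq_square) (simp add: algebra_simps)
      also have "(1 - (s z)\<^sup>2) / b = deriv v z"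
        using bu[OF that] b by (simp add: nonzero_divide_eq_eq mult.commute)
      finally show ?thesis
        using der_u[OF that] by (simp add: left_diff_distrib)
    qed
    have "continuous_on I s"
      using isCont_s by (intro continuous_at_imp_continuous_on) blast
    then have "continuous_on I (\<lambda>z. 1 - 1 / (s z + 1)\<^sup>2)"
      using s_neq_m1 by (intro continuous_intros) (auto simp: add_eq_0_iff2)
    then have "deriv v x = 0"
      using linear_ode_zero[OF interval_I der _ n_I un, of x] x by blast
    then show False
      using bu[of x] x by simp
  qed
qed

text \<open>The junctions are the frontier points, inside \<open>I\<close>, of the zero set
  \<open>Z\<close> of \<open>s\<close>. An interval avoiding them either misses \<open>Z\<close>,
  where the previous results apply, or lies inside \<open>Z\<close>, where the slope is
  \<open>1 / b = (- 1 + sqrt 4) / b\<close>.\<close>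

lemma glued:
  assumes q4: "q = 4" and tw: "twice_differentiable_on v I"
  shows "v \<in> glued_first_order_solutions q b I"
proof -
  define Z where "Z = {z \<in> I. s z = 0}"
  define D where "D = I \<inter> frontier Z"
  have "finite D"
    unfolding D_def Z_def using finite_frontier_interval[OF zeros_is_interval[OF q4]] by simp
  have "continuous_on I s"
    using isCont_s by (intro continuous_at_imp_continuous_on) blast
  then have "open (I \<inter> s -` (- {0}))"
    using open_I by (intro continuous_open_preimage) auto
  moreover have "(I \<inter> s -` (- {0})) \<inter> Z = {}"
    by (auto simp: Z_def)
  \<comment> \<open>By continuity of \<open>s\<close> the set \<open>Z\<close> is closed relative to
    \<open>I\<close>, so its frontier points in \<open>I\<close> belong to \<open>Z\<close> and
    satisfy \<open>p = 0\<close>.\<close>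
  ultimately have "(I \<inter> s -` (- {0})) \<inter> closure Z = {}"
    by (simp add: open_Int_closure_eq_empty)
  then have D_Z: "D \<subseteq> Z"
    by (auto simp: D_def Z_def frontier_def)
  have "v \<in> first_order_solutions q b J" if J: "open J" "is_interval J" "J \<subseteq> I - D" for J
  proof (cases "J \<inter> Z = {}")
    case True
    show ?thesis
      by (rule first_order_where_nonzero) (use J True in \<open>auto simp: Z_def\<close>)
  next
    case False
    have "J \<inter> frontier Z = {}"
      using J(3) by (auto simp: D_def)
    then have "J \<subseteq> Z"
      using connected_Int_frontier[of J Z] False J(2) is_interval_connected by blast
    then have JZ: "z \<in> I" "s z = 0" if "z \<in> J" for z
      using that by (auto simp: Z_def)
    have "deriv v z = 1 / b" if "z \<in> J" for z
      using u_eq[OF JZ(1)[OF that]] JZ(2)[OF that] q4 by simp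
    then have "v \<in> linear_solutions ((- 1 + sqrt q) / b) J"
      using der_v[OF JZ(1)] q4 by (simp add: linear_solutions_def)
    then show ?thesis
      using q4 by (simp add: first_order_solutions_def)
  qed
  moreover have "p_of q b v z = 0" if "z \<in> D" for z
    using D_Z that p_of_eq by (auto simp: Z_def)
  ultimately show ?thesis
    unfolding glued_first_order_solutions_def using tw \<open>finite D\<close> by (auto simp: D_def)
qed

end

text \<open>Away from the junctions the equation holds locally by the first inclusion. At a junction
  \<open>b * deriv v z\<close> attains its upper bound 1, so the second derivative vanishes;
  together with \<open>deriv v z = 1 / b\<close> this satisfies the equation for
  \<open>q = 4\<close>, with denominator base \<open>1 - b * (0 - 1 / b) = 2\<close>.\<close>

lemma glued_subset_second_order:
  assumes q4: "q = 4" and b: "b \<noteq> 0" and I: "open I"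
  shows "glued_first_order_solutions q b I \<subseteq> second_order_solutions q b I"
proof
  fix v assume "v \<in> glued_first_order_solutions q b I"
  then obtain D where tw: "twice_differentiable_on v I" and D: "finite D" "D \<subseteq> I"
    and p0: "\<And>z. z \<in> D \<Longrightarrow> p_of q b v z = 0"
    and first: "\<And>J. open J \<Longrightarrow> is_interval J \<Longrightarrow> J \<subseteq> I - D \<Longrightarrow> v \<in> first_order_solutions q b J"
    unfolding glued_first_order_solutions_def by blast
  have q: "q \<noteq> 0"
    using q4 by simp
  have off: "\<exists>e>0. v \<in> second_order_solutions q b (ball z e)" if z: "z \<in> I" "z \<notin> D" for z
  proof -
    have "open (I - D)"
      using I D(1) by (intro open_Diff finite_imp_closed)
    then obtain e where e: "e > 0" "ball z e \<subseteq> I - D"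
      using z by (meson DiffI open_contains_ball)
    then have "v \<in> first_order_solutions q b (ball z e)"
      by (intro first) (simp_all add: is_interval_ball_real)
    then have "v \<in> second_order_solutions q b (ball z e)"
      using first_order_subset_second_order[OF q b open_ball] by blast
    then show ?thesis
      using e(1) by blast
  qed
  have on: "b * deriv v z = 1" if "z \<in> D" for z
    using p0[OF that] by (simp add: p_of_def q4)
  \<comment> \<open>Off \<open>D\<close> the bound comes from the parametrization
    \<open>1 - (s z)\<^sup>2\<close>, on \<open>D\<close> from equality.\<close>
  have le: "b * deriv v z \<le> 1" if z: "z \<in> I" for z
  proof (cases "z \<in> D")
    case False
    then obtain e where e: "e > 0" "v \<in> second_order_solutions q b (ball z e)"
      using off z by blast
    obtain s where "\<And>y. y \<in> ball z e \<Longrightarrow> deriv v y = q * (1 - (s y)\<^sup>2) / (4 * b)"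
      using second_order_solutionsE[OF q b e(2)] by metis
    from this[of z] have "b * deriv v z = 1 - (s z)\<^sup>2"
      using e(1) b q4 by simp
    then show ?thesis
      by simp
  qed (simp add: on)
  have "1 - b * (deriv (deriv v) z - deriv v z) \<noteq> 0 \<and>
      deriv v z + q * ((deriv (deriv v) z - deriv v z) /
        (1 - b * (deriv (deriv v) z - deriv v z))\<^sup>2) = 0" if z: "z \<in> I" for z
  proof (cases "z \<in> D")
    case True
    obtain e where e: "e > 0" "ball z e \<subseteq> I"
      using I z by (meson open_contains_ball)
    have "(deriv v has_real_derivative deriv (deriv v) z) (at z)"
      using tw z DERIV_deriv_iff_real_differentiable unfolding twice_differentiable_on_def by blast
    then have "((\<lambda>y. b * deriv v y) has_real_derivative b * deriv (deriv v) z) (at z)"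
      by (rule DERIV_cmult)
    moreover have "\<forall>y. \<bar>z - y\<bar> < e \<longrightarrow> b * deriv v y \<le> b * deriv v z"
      using le on[OF True] e(2) by (auto simp: dist_real_def subset_iff)
    ultimately have "b * deriv (deriv v) z = 0"
      using e(1) DERIV_local_max by blast
    moreover have "deriv v z = 1 / b"
      using on[OF True] b by (simp add: field_simps)
    ultimately show ?thesis
      using b q4 by simp
  next
    case False
    then obtain e where "e > 0" "v \<in> second_order_solutions q b (ball z e)"
      using off z by blast
    then show ?thesis
      unfolding second_order_solutions_def by auto
  qed
  then show "v \<in> second_order_solutions q b I"
    using tw unfolding second_order_solutions_def by blast
qed

lemma second_order_subset_glued:
  assumes q4: "q = 4" and b: "b \<noteq> 0" and I: "open I" "is_interval I"
  shows "second_order_solutions q b I \<subseteq> glued_first_order_solutions q b I"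
proof
  fix v assume v: "v \<in> second_order_solutions q b I"
  have q: "q \<noteq> 0"
    using q4 by simp
  obtain s where "second_order_solution q b I v s"
    using second_order_solutionsE[OF q b v] q b I
    unfolding second_order_solution_def by metis
  then interpret second_order_solution q b I v s .
  show "v \<in> glued_first_order_solutions q b I"
    using glued[OF q4] v by (simp add: second_order_solutions_def)
qed

theorem theorem4p1:
  fixes q b :: real and I :: "real set"
  assumes "q \<noteq> 0" and "b \<noteq> 0"
    and "open I" and "is_interval I" and "I \<noteq> {}"
  shows "first_order_solutions q b I \<subseteq> second_order_solutions q b I \<and>
    (q \<noteq> 4 \<longrightarrow> second_order_solutions q b I = first_order_solutions q b I) \<and>
    (q = 4 \<longrightarrow> second_order_solutions q b I = glued_first_order_solutions q b I)"
  using first_order_subset_second_order[OF assms(1-3)]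
    second_order_subset_first_order[OF assms(1) _ assms(2-4)]
    glued_subset_second_order[OF _ assms(2,3)] second_order_subset_glued[OF _ assms(2-4)]
  by (intro conjI impI subset_antisym)

end
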